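(* Let $R\in\mathbb{C}[s]$ and $f\in\mathbb{C}(u,s)$, and suppose that the pair $(R,f)$ defines a quasi-orthogonal HG-family. Then the pair $(R,f)$ belongs to the following list. (a) $R$ has degree $\le 2$, and there exist polynomials $q,v\in\mathbb{C}[t]$ of degree $\le 1$ such that $$f(u,s)=\frac{(s-u)\,q(s+u)}{s\,q(s)\,[R(s+1)-R(0)]+(s+1)\,v(s)}.$$ (b) $R$ is a constant, and for some constants $c,\lambda\in\mathbb{C}$ $$f(u,s)=\lambda(s-u)(s-u+1-c)\frac{(s+u+1)(s+u+c)}{(s+1/2)(s+1)}.$$ (c) $R$ is a constant, and for some constants $c,\lambda\in\mathbb{C}$ $$f(u,s)=\lambda(s-u)(s-u+1-c)\frac{(s+u+2)(s+u+c+1)}{(s+1)(s+3/2)}.$$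
   Context: A family of polynomials is a sequence $\mathcal{P}=(P_0,P_1,\dots)$ where $P_n\in\mathbb{C}[z]$ is monic of degree $n$. For $R\in\mathbb{C}[s]$ the Newtonian basis given by $R$ is the sequence $\{\Phi_k\}$ with $\Phi_{-1}=0$, $\Phi_0=1$, $\Phi_{k+1}=z\Phi_k+R(k)\Phi_k$ for $k\ge 0$. Given a Newtonian basis, write $P_n=\sum_{k=0}^n c(n,k)\Phi_k$; thus $c(n,n)=1$ for $n\ge 0$, and set $c(n,k)=0$ unless $n\ge k\ge 0$, so $c$ is a function on $\mathbb{Z}^2$. $\mathcal{P}$ is a rational HG-family if there exist relatively prime polynomials $N(u,s),D(u,s)\in\mathbb{C}[u,s]$ and a Newtonian basis $\{\Phi_k\}$ given by some $R\in\mathbb{C}[s]$ such that the coefficients satisfy $D(n,k)c(n,k+1)=N(n,k)c(n,k)$ for all $n,k\in\mathbb{Z}$. It is then said to be given (or defined) by the pair $(R,f)$, where $f=N/D\in\mathbb{C}(u,s)$. It is an HG-family if moreover $D\in\mathbb{C}[s]$, i.e. $D$ does not depend on $u$. A family $\mathcal{P}$ is quasi-orthogonal if there is a linear functional $M:\mathbb{C}[z]\to\mathbb{C}$ with $M(P_iP_j)=0$ for $i\ne j$ and $M(P_i^2)\neq 0$ for all $i$. *)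

theory Defs
  imports Complex_Main "HOL-Computational_Algebra.Computational_Algebra"
begin

definition poly_family :: "(nat \<Rightarrow> complex poly) \<Rightarrow> bool" where
  "poly_family P \<longleftrightarrow> (\<forall>n. degree (P n) = n \<and> lead_coeff (P n) = 1)"

text \<open>Indices start at 0; the convention that the basis element of index -1 is zero is not needed.\<close>

fun newton_basis :: "complex poly \<Rightarrow> nat \<Rightarrow> complex poly" where
  "newton_basis R 0 = 1"
| "newton_basis R (Suc k) =
     [:0, 1:] * newton_basis R k + smult (poly R (of_nat k)) (newton_basis R k)"

text \<open>
  Since the Newtonian basis is a basis with one element in each degree, at most one
  function \<open>c\<close> satisfies the following, and exactly one does if \<open>P\<close> is a family.
\<close>

definition newton_coeffs ::
  "complex poly \<Rightarrow> (nat \<Rightarrow> complex poly) \<Rightarrow> (int \<Rightarrow> int \<Rightarrow> complex) \<Rightarrow> bool" where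
  "newton_coeffs R P c \<longleftrightarrow>
     (\<forall>n::nat. P n = (\<Sum>k\<le>n. smult (c (int n) (int k)) (newton_basis R k))) \<and>
     (\<forall>n k::int. \<not> (n \<ge> k \<and> k \<ge> 0) \<longrightarrow> c n k = 0)"

text \<open>
  An element of \<open>\<complex>[u,s] = \<complex>[s][u]\<close> is a \<open>complex poly poly\<close> whose outer variable is \<open>u\<close> and
  whose inner variable is \<open>s\<close>; thus the elements of \<open>\<complex>[s]\<close> are the polynomials \<open>[:d:]\<close>.
  An element of \<open>\<complex>(u,s)\<close> is a \<open>complex poly poly fract\<close>.
\<close>

definition eval2 :: "complex poly poly \<Rightarrow> complex \<Rightarrow> complex \<Rightarrow> complex" where
  "eval2 F x y = poly (poly F [:x:]) y"

definition var_u :: "complex poly poly fract" where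
  "var_u = to_fract [:0, 1:]"

definition var_s :: "complex poly poly fract" where
  "var_s = to_fract [:[:0, 1:]:]"

definition rat_const :: "complex \<Rightarrow> complex poly poly fract" where
  "rat_const a = to_fract [:[:a:]:]"

text \<open>Substitution of a rational function into a univariate polynomial.\<close>

definition rat_subst ::
  "complex poly \<Rightarrow> complex poly poly fract \<Rightarrow> complex poly poly fract" where
  "rat_subst p x = poly (map_poly rat_const p) x"

definition hg_relation ::
  "complex poly poly \<Rightarrow> complex poly poly \<Rightarrow> complex poly \<Rightarrow> (nat \<Rightarrow> complex poly) \<Rightarrow> bool" where
  "hg_relation N D R P \<longleftrightarrow>
     (\<exists>c. newton_coeffs R P c \<and>
          (\<forall>n k::int. eval2 D (of_int n) (of_int k) * c n (k + 1)
                    = eval2 N (of_int n) (of_int k) * c n k))"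

definition HG_family_given_by ::
  "complex poly \<Rightarrow> complex poly poly fract \<Rightarrow> (nat \<Rightarrow> complex poly) \<Rightarrow> bool" where
  "HG_family_given_by R f P \<longleftrightarrow>
     poly_family P \<and>
     (\<exists>N D. coprime N D \<and> D \<noteq> 0 \<and> f = to_fract N / to_fract D \<and> hg_relation N D R P \<and>
            (\<exists>d. D = [:d:]))"

text \<open>The unqualified predicate \<open>linear\<close> would only express linearity over the reals.\<close>

definition quasi_orthogonal :: "(nat \<Rightarrow> complex poly) \<Rightarrow> bool" where
  "quasi_orthogonal P \<longleftrightarrow>
     (\<exists>M :: complex poly \<Rightarrow> complex.
        Vector_Spaces.linear smult (*) M \<and>
        (\<forall>i j. i \<noteq> j \<longrightarrow> M (P i * P j) = 0) \<and>
        (\<forall>i. M (P i ^ 2) \<noteq> 0))"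

end

theory Submission
  imports Defs "HOL-Analysis.Continuum_Not_Denumerable"
begin

text \<open>
  Write \<open>f = N / d\<close> with \<open>d\<close> a polynomial in \<open>s\<close>.  Quasi-orthogonality gives a three-term
  recurrence with non-vanishing lower coefficient.  After division by \<open>c n 0\<close>, its Newton
  coefficients are polynomials in \<open>n\<close>, so by Cramer's rule the recurrence holds for generic
  complex \<open>u\<close> in place of \<open>n\<close>.  Dividing by the \<open>k\<close>-th coefficient leaves a sum of two
  hypergeometric terms in \<open>k\<close>, with quotients \<open>N (u \<plusminus> 1) k / N u k\<close>; two consecutive equations
  determine both terms, which are therefore rational in \<open>k\<close>.

  The poles of the sum are exactly the roots of \<open>N u (s - 1)\<close>.  Following the rightmost root in a
  coset of the integers from \<open>u\<close> to \<open>u \<plusminus> 1\<close> shows that it moves by exactly one in each step, so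
  every root of \<open>N u\<close> lies on one of finitely many lines \<open>s = \<plusminus>u + const\<close> up to integers.
  Since uncountably many \<open>u\<close> are available, \<open>N\<close> is a product \<open>\<kappa> A (s - u) B (s + u)\<close>.
  The recurrence then becomes an explicit polynomial identity.  Evaluating it at two roots of
  \<open>A\<close> (or at a double root) gives \<open>deg d = deg B\<close>, symmetrically \<open>deg d = deg A\<close>, and comparing
  the leading coefficients in \<open>s\<close> excludes everything but \<open>deg A = 1, deg B \<le> 1\<close> and
  \<open>deg A = deg B = 2\<close>.
\<close>

section \<open>Polynomial coefficients and the lattice identity\<close>

text \<open>For an integer \<open>n\<close> the coefficients terminate (\<open>N n n = 0\<close>),
  so one recurrence equation concerns only finitely many \<open>k\<close> and cannot show that a
  term is rational in \<open>k\<close>. Continuing to complex \<open>u\<close> removes the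
  termination. The price is an exceptional set that is countable instead of finite: each column
  \<open>k\<close> contributes its own zeros of \<open>N\<close>, and all integer translates must be
  avoided too, because the walk moves \<open>u\<close> by integers. That \<open>d\<close> is free of
  \<open>u\<close> matters twice: it cancels from the term ratios, and it stays fixed while the
  roots of the numerator move. The constants in (b) and (c) have one source. For
  \<open>deg A = deg B = 2\<close> the identity forces \<open>d\<close> to be proportional to (s +
  \<sigma>/4)(s + (\<sigma> + 2)/4), where \<sigma> is the sum of the linear coefficients of
  \<open>A\<close> and \<open>B\<close>. Since \<open>c 0 (-1) = 0\<close> makes -1 a root of
  \<open>d\<close>, only \<sigma> = 2 and \<sigma> = 4 survive, which are (b) and (c).\<close>

lemma poly_eqI_infinite:
  fixes p q :: "complex poly"
  assumes "infinite S" "\<And>x. x \<in> S \<Longrightarrow> poly p x = poly q x"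
  shows "p = q"
proof (rule ccontr)
  assume "p \<noteq> q"
  then have "finite {x. poly (p - q) x = 0}"
    by (intro poly_roots_finite) auto
  moreover have "S \<subseteq> {x. poly (p - q) x = 0}"
    using assms(2) by auto
  ultimately show False
    using assms(1) finite_subset by blast
qed

section \<open>Top three coefficients of products and of shifted polynomials\<close>

lemma coeff_mult_degree_le:
  assumes "degree p \<le> m" "degree q \<le> n"
  shows "coeff (p * q) (m + n) = coeff p m * coeff q n"
proof -
  have "coeff (p * q) (m + n) = (\<Sum>i\<le>m + n. coeff p i * coeff q (m + n - i))"
    by (rule coeff_mult)
  also have "\<dots> = (\<Sum>i\<in>{m}. coeff p i * coeff q (m + n - i))"
  proof (rule sum.mono_neutral_right)
    show "\<forall>i\<in>{..m + n} - {m}. coeff p i * coeff q (m + n - i) = 0"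
    proof
      fix i assume "i \<in> {..m + n} - {m}"
      then have "i > m \<or> m + n - i > n" by auto
      then show "coeff p i * coeff q (m + n - i) = 0"
        using assms by (auto simp: coeff_eq_0)
    qed
  qed auto
  finally show ?thesis by simp
qed

lemma coeff_mult_second:
  assumes "degree p \<le> Suc m" "degree q \<le> Suc n"
  shows "coeff (p * q) (Suc (m + n)) = coeff p (Suc m) * coeff q n + coeff p m * coeff q (Suc n)"
proof -
  have "coeff (p * q) (Suc (m + n)) = (\<Sum>i\<le>Suc (m + n). coeff p i * coeff q (Suc (m + n) - i))"
    by (rule coeff_mult)
  also have "\<dots> = (\<Sum>i\<in>{m, Suc m}. coeff p i * coeff q (Suc (m + n) - i))"
  proof (rule sum.mono_neutral_right)
    show "\<forall>i\<in>{..Suc (m + n)} - {m, Suc m}. coeff p i * coeff q (Suc (m + n) - i) = 0"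
    proof
      fix i assume "i \<in> {..Suc (m + n)} - {m, Suc m}"
      then have "i > Suc m \<or> Suc (m + n) - i > Suc n" by auto
      then show "coeff p i * coeff q (Suc (m + n) - i) = 0"
        using assms by (auto simp: coeff_eq_0)
    qed
  qed auto
  finally show ?thesis by (simp add: Suc_diff_le add.commute)
qed

lemma coeff_mult_third:
  assumes "degree p \<le> Suc (Suc m)" "degree q \<le> Suc (Suc n)"
  shows "coeff (p * q) (Suc (Suc (m + n))) =
    coeff p (Suc (Suc m)) * coeff q n + coeff p (Suc m) * coeff q (Suc n) + coeff p m * coeff q (Suc (Suc n))"
proof -
  let ?N = "Suc (Suc (m + n))"
  have "coeff (p * q) ?N = (\<Sum>i\<le>?N. coeff p i * coeff q (?N - i))"
    by (rule coeff_mult)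
  also have "\<dots> = (\<Sum>i\<in>{m, Suc m, Suc (Suc m)}. coeff p i * coeff q (?N - i))"
  proof (rule sum.mono_neutral_right)
    show "\<forall>i\<in>{..?N} - {m, Suc m, Suc (Suc m)}. coeff p i * coeff q (?N - i) = 0"
    proof
      fix i assume "i \<in> {..?N} - {m, Suc m, Suc (Suc m)}"
      then have "i > Suc (Suc m) \<or> ?N - i > Suc (Suc n)" by auto
      then show "coeff p i * coeff q (?N - i) = 0"
        using assms by (auto simp: coeff_eq_0)
    qed
  qed auto
  finally show ?thesis by (simp add: Suc_diff_le algebra_simps)
qed

abbreviation shift_poly :: "complex \<Rightarrow> complex poly \<Rightarrow> complex poly" where
  "shift_poly h p \<equiv> pcompose p [:h, 1:]"

lemma degree_shift_poly [simp]: "degree (shift_poly h p) = degree p"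
  by (simp add: degree_pcompose)

lemma poly_shift_poly [simp]: "poly (shift_poly h p) x = poly p (x + h)"
  by (simp add: poly_pcompose add.commute)

lemma coeff_shift_pCons:
  "coeff (shift_poly h (pCons a p)) (Suc n) = h * coeff (shift_poly h p) (Suc n) + coeff (shift_poly h p) n"
  by (simp add: pcompose_pCons)

lemma coeff_shift_top:
  "degree p \<le> n \<Longrightarrow> coeff (shift_poly h p) n = coeff p n"
proof (induction n arbitrary: p)
  case 0
  then obtain a where "p = [:a:]" by (metis le_zero_eq degree_eq_zeroE)
  then show ?case by simp
next
  case (Suc n)
  obtain a q where p: "p = pCons a q" by (cases p)
  have "degree q \<le> n" using Suc.prems p by (auto split: if_splits)
  moreover have "coeff (shift_poly h q) (Suc n) = 0"
    using calculation by (intro coeff_eq_0) simp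
  ultimately show ?case using Suc.IH[of q] p by (simp add: coeff_shift_pCons)
qed

lemma coeff_shift_second:
  "degree p \<le> Suc n \<Longrightarrow>
    coeff (shift_poly h p) n = coeff p n + of_nat (Suc n) * h * coeff p (Suc n)"
proof (induction n arbitrary: p)
  case 0
  obtain a q where p: "p = pCons a q" by (cases p)
  have "degree q \<le> 0" using 0 p by (auto split: if_splits)
  then obtain b where "q = [:b:]" by (metis le_zero_eq degree_eq_zeroE)
  then show ?case using p by (simp add: pcompose_pCons)
next
  case (Suc n)
  obtain a q where p: "p = pCons a q" by (cases p)
  have "degree q \<le> Suc n" using Suc.prems p by (auto split: if_splits)
  then show ?case
    using Suc.IH[of q] coeff_shift_top[of q "Suc n" h] p
    by (simp add: coeff_shift_pCons algebra_simps)
qed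

lemma coeff_shift_third:
  "degree p \<le> Suc (Suc n) \<Longrightarrow>
    coeff (shift_poly h p) n = coeff p n + of_nat (Suc n) * h * coeff p (Suc n)
      + of_nat (Suc n) * of_nat (Suc (Suc n)) / 2 * h\<^sup>2 * coeff p (Suc (Suc n))"
proof (induction n arbitrary: p)
  case 0
  obtain a q where p: "p = pCons a q" by (cases p)
  have "degree q \<le> Suc 0" using 0 p by (auto split: if_splits)
  then obtain b c where "q = [:b, c:]"
    by (metis degree_pCons_eq_if le_zero_eq degree_eq_zeroE pCons_cases Suc_le_mono pCons_0_0)
  then show ?case using p by (simp add: pcompose_pCons power2_eq_square algebra_simps)
next
  case (Suc n)
  obtain a q where p: "p = pCons a q" by (cases p)
  have "degree q \<le> Suc (Suc n)" using Suc.prems p by (auto split: if_splits)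
  then show ?case
    using Suc.IH[of q] coeff_shift_second[of q "Suc n" h] p
    by (simp add: coeff_shift_pCons algebra_simps power2_eq_square add_divide_distrib)
qed

text \<open>
  The Newton coefficients of the three-term recurrence when the numerator is
  \<open>A (s - u) * B (s + u)\<close> and \<open>r s = R (s + 1) - R 0\<close>.  The substitution \<open>u \<mapsto> -u\<close> exchanges
  \<open>A\<close> with \<open>B\<close> and \<open>a\<close> with \<open>b\<close>.
\<close>

definition lattice_identity ::
  "complex set \<Rightarrow> complex poly \<Rightarrow> complex poly \<Rightarrow> complex poly \<Rightarrow> complex poly \<Rightarrow>
    (complex \<Rightarrow> complex) \<Rightarrow> (complex \<Rightarrow> complex) \<Rightarrow> (complex \<Rightarrow> complex) \<Rightarrow> bool" where
  "lattice_identity S A B D r C a b \<longleftrightarrow>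
    infinite S \<and> (\<forall>u\<in>S. a u \<noteq> 0 \<and> b u \<noteq> 0 \<and>
      D + ([:C u:] - r) * (shift_poly (-u) A * shift_poly u B) =
        smult (a u) (shift_poly (u + 1) B * shift_poly u B) +
        smult (b u) (shift_poly (1 - u) A * shift_poly (-u) A))"

lemma lattice_identityD:
  assumes "lattice_identity S A B D r C a b" "u \<in> S"
  shows "D + ([:C u:] - r) * (shift_poly (-u) A * shift_poly u B) =
        smult (a u) (shift_poly (u + 1) B * shift_poly u B) +
        smult (b u) (shift_poly (1 - u) A * shift_poly (-u) A)"
    and "a u \<noteq> 0" "b u \<noteq> 0"
  using assms by (auto simp: lattice_identity_def)

lemma lattice_identity_swap:
  assumes "lattice_identity S A B D r C a b"
  shows "lattice_identity (uminus ` S) B A D r (\<lambda>u. C (-u)) (\<lambda>u. b (-u)) (\<lambda>u. a (-u))"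
  using assms unfolding lattice_identity_def
  by (auto simp: finite_image_iff inj_on_def add.commute mult.commute mult.left_commute)

text \<open>If x is a root of \<open>A\<close>, the right side of the lattice identity at s = u + x
  is \<open>a u\<close> times B(2u + x) B(2u + x + 1). Written in the variable w = u + x/2 this is
  one polynomial for all roots x, so two roots differ only by shifts: by x in \<open>D\<close> and
  by x/2 here.\<close>

definition doubled_product :: "complex poly \<Rightarrow> complex poly" where
  "doubled_product B = pcompose B [:0, 2:] * pcompose B [:1, 2:]"

lemma poly_doubled_product: "poly (doubled_product B) w = poly B (2 * w) * poly B (2 * w + 1)"
  by (simp add: doubled_product_def poly_pcompose algebra_simps)

lemma degree_doubled_product: "B \<noteq> 0 \<Longrightarrow> degree (doubled_product B) = 2 * degree B"
  unfolding doubled_product_def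
  by (subst degree_mult_eq) (auto simp: degree_pcompose pcompose_eq_0_iff)

lemma doubled_product_eq_0_iff: "doubled_product B = 0 \<longleftrightarrow> B = 0"
  by (auto simp: doubled_product_def pcompose_eq_0_iff)

lemma lattice_identity_root:
  assumes I: "lattice_identity S A B D r C a b" and u: "u \<in> S" and x: "poly A x = 0"
  shows "poly D (u + x) = a u * poly (doubled_product B) (u + x / 2)"
  using arg_cong[OF lattice_identityD(1)[OF I u], of "\<lambda>p. poly p (u + x)"] x
  by (simp add: poly_doubled_product algebra_simps)

text \<open>The identity is differentiated in \<open>s\<close>, for which \<open>a u\<close> is a
  constant; every term with the factor A(s - u) still vanishes at a double root. The factor 2 arises
  because \<open>doubled_product\<close> has the argument 2w.\<close>

lemma lattice_identity_double_root:
  assumes I: "lattice_identity S A B D r C a b" and u: "u \<in> S"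
    and x: "poly A x = 0" "poly (pderiv A) x = 0"
  shows "2 * poly (pderiv D) (u + x) = a u * poly (pderiv (doubled_product B)) (u + x / 2)"
proof -
  have e1: "poly (pderiv (D + ([:C u:] - r) * (shift_poly (-u) A * shift_poly u B))) (u + x) =
      poly (pderiv D) (u + x)"
    using x by (simp add: pderiv_mult pderiv_add pderiv_pcompose pderiv_pCons)
  have e2: "poly (pderiv (smult (a u) (shift_poly (u + 1) B * shift_poly u B) +
      smult (b u) (shift_poly (1 - u) A * shift_poly (-u) A))) (u + x) =
      a u * (poly (pderiv B) (2 * u + x + 1) * poly B (2 * u + x) +
             poly B (2 * u + x + 1) * poly (pderiv B) (2 * u + x))"
    using x by (simp add: pderiv_mult pderiv_add pderiv_smult pderiv_pcompose pderiv_pCons algebra_simps)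
  have e3: "poly (pderiv (doubled_product B)) (u + x / 2) =
      2 * (poly (pderiv B) (2 * u + x + 1) * poly B (2 * u + x) +
             poly B (2 * u + x + 1) * poly (pderiv B) (2 * u + x))"
    unfolding doubled_product_def
    by (simp add: pderiv_mult pderiv_pcompose pderiv_pCons poly_pcompose algebra_simps)
  show ?thesis
    unfolding e1[symmetric] lattice_identityD(1)[OF I u] e2 e3 by simp
qed

section \<open>Degree constraints from the roots of \<open>A\<close> and \<open>B\<close>\<close>

lemma lead_coeff_pderiv_complex:
  fixes p :: "complex poly"
  shows "lead_coeff (pderiv p) = of_nat (degree p) * lead_coeff p"
proof (cases "degree p")
  case 0
  then obtain a where "p = [:a:]" by (meson degree_eq_zeroE)
  then show ?thesis by (simp add: pderiv_pCons)
next
  case (Suc n)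
  then show ?thesis by (simp add: degree_pderiv coeff_pderiv)
qed

lemma two_roots:
  fixes A :: "complex poly"
  assumes "degree A \<ge> 2"
  obtains x y where "poly A x = 0" "poly A y = 0" "x \<noteq> y"
  | x where "poly A x = 0" "poly (pderiv A) x = 0"
proof -
  have "\<not> constant (poly A)" using assms by (simp add: constant_degree)
  then obtain x where x: "poly A x = 0" using fundamental_theorem_of_algebra by blast
  then obtain G where G: "A = [:-x, 1:] * G" by (auto simp: poly_eq_0_iff_dvd)
  have "G \<noteq> 0" using assms G by auto
  then have "degree A = Suc (degree G)" unfolding G by (subst degree_mult_eq) auto
  then have "\<not> constant (poly G)" using assms by (simp add: constant_degree)
  then obtain y where y: "poly G y = 0" using fundamental_theorem_of_algebra by blast
  show thesis
  proof (cases "x = y")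
    case True
    then have "poly (pderiv A) x = 0" using y unfolding G
      by (simp add: pderiv_mult pderiv_pCons del: mult_pCons_left)
    then show ?thesis using that(2) x by blast
  next
    case False
    then show ?thesis using that(1)[of x y] x y G by auto
  qed
qed

text \<open>Two relations at fixed \<open>u\<close> eliminate the unknown \<open>a u\<close>. With K
  = \<open>doubled_product B\<close>, distinct roots x, y give D(u + x) K(u + y/2) = D(u + y) K(u +
  x/2); the second highest coefficients yield (deg K - 2 deg D)(x - y) = 0. A double root gives D K'
  = 2 D' K up to the same shifts, and the leading coefficients yield deg K = 2 deg D again. Finally
  deg K = 2 deg B.\<close>

lemma lattice_identity_degree:
  assumes I: "lattice_identity S A B D r C a b" and A: "degree A \<ge> 2" and B: "B \<noteq> 0"
    and D: "degree D \<ge> 1"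
  shows "degree D = degree B"
proof -
  define K where "K = doubled_product B"
  have K0: "K \<noteq> 0" and dK: "degree K = 2 * degree B"
    using B by (simp_all add: K_def degree_doubled_product doubled_product_eq_0_iff)
  have S: "infinite S" using I by (simp add: lattice_identity_def)
  obtain n where n: "degree D = Suc n" using D by (cases "degree D") auto
  have lD: "coeff D (Suc n) \<noteq> 0" using n by (metis leading_coeff_0_iff degree_0 nat.distinct(1))
  from A show ?thesis
  proof (cases rule: two_roots)
    case (1 x y)
    have eq: "shift_poly x D * shift_poly (y/2) K = shift_poly y D * shift_poly (x/2) K"
    proof (rule poly_eqI_infinite[OF S])
      fix u assume "u \<in> S"
      then show "poly (shift_poly x D * shift_poly (y/2) K) u = poly (shift_poly y D * shift_poly (x/2) K) u"
        using lattice_identity_root[OF I _ 1(1)] lattice_identity_root[OF I _ 1(2)]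
        by (simp add: K_def)
    qed
    show ?thesis
    proof (cases "degree K")
      case 0
      then obtain k where "K = [:k:]" by (meson degree_eq_zeroE)
      then have "smult k (shift_poly x D - shift_poly y D) = 0" "k \<noteq> 0"
        using eq K0 by (auto simp: smult_diff_right)
      then have "shift_poly x D = shift_poly y D" by (metis smult_eq_0_iff right_minus_eq)
      then have "coeff (shift_poly x D) n = coeff (shift_poly y D) n" by simp
      then have "of_nat (Suc n) * (x - y) * coeff D (Suc n) = 0"
        using n by (simp add: coeff_shift_second algebra_simps del: of_nat_Suc)
      then show ?thesis using 1(3) lD by (simp del: of_nat_Suc)
    next
      case (Suc m)
      have lK: "coeff K (Suc m) \<noteq> 0" using Suc K0 by (metis leading_coeff_0_iff)
      have "coeff (shift_poly z D * shift_poly (w/2) K) (Suc (n + m)) =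
          coeff D (Suc n) * (coeff K m + of_nat (Suc m) * (w/2) * coeff K (Suc m)) +
          (coeff D n + of_nat (Suc n) * z * coeff D (Suc n)) * coeff K (Suc m)" for z w
        using n Suc
        by (simp add: coeff_mult_second coeff_shift_second coeff_shift_top coeff_eq_0 del: of_nat_Suc)
      from this[of x y] this[of y x]
      have "(of_nat (Suc m) - 2 * of_nat (Suc n)) * (x - y) * (coeff D (Suc n) * coeff K (Suc m)) = 0"
        unfolding eq by (simp add: field_simps del: of_nat_Suc)
      then have "(of_nat (Suc m) :: complex) = of_nat (2 * Suc n)"
        unfolding of_nat_mult of_nat_numeral using lK lD 1(3) by (simp del: of_nat_Suc)
      then have "Suc m = 2 * Suc n" by (metis of_nat_eq_iff)
      then show ?thesis using n Suc dK by simp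
    qed
  next
    case (2 x)
    have eq: "shift_poly x D * shift_poly (x/2) (pderiv K) =
      smult 2 (shift_poly x (pderiv D) * shift_poly (x/2) K)"
    proof (rule poly_eqI_infinite[OF S])
      fix u assume u: "u \<in> S"
      show "poly (shift_poly x D * shift_poly (x/2) (pderiv K)) u =
        poly (smult 2 (shift_poly x (pderiv D) * shift_poly (x/2) K)) u"
        using lattice_identity_root[OF I u 2(1)] lattice_identity_double_root[OF I u 2]
        by (simp add: K_def)
    qed
    have "lead_coeff (shift_poly x D * shift_poly (x/2) (pderiv K)) =
        lead_coeff (smult 2 (shift_poly x (pderiv D) * shift_poly (x/2) K))" using eq by simp
    then have "lead_coeff D * (of_nat (degree K) * lead_coeff K) =
        2 * (of_nat (degree D) * lead_coeff D * lead_coeff K)"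
      by (simp add: lead_coeff_mult coeff_shift_top lead_coeff_pderiv_complex)
    then have "(of_nat (degree K) :: complex) = of_nat (2 * degree D)"
      using K0 D by (auto simp del: of_nat_Suc)
    then have "degree K = 2 * degree D" by (metis of_nat_eq_iff)
    then show ?thesis using dK by simp
  qed
qed

text \<open>In degree 2 deg A of \<open>s\<close> only the product with \<open>r\<close> and the
  term with \<open>b u\<close> survive, so \<open>b u\<close> is a nonzero constant independent of
  \<open>u\<close>. The relation at a root of \<open>B\<close> then equates \<open>D\<close>, up to
  shifts and a constant, with \<open>doubled_product A\<close>, whose degree 2 deg A exceeds deg D =
  deg B.\<close>

lemma lattice_identity_not_greater:
  assumes I: "lattice_identity S A B D r C a b"
    and A: "lead_coeff A = 1" and B: "lead_coeff B = 1" "degree B < degree A"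
    and D: "degree D = degree B" "degree D \<ge> 1"
  shows False
proof -
  have S: "infinite S" using I by (simp add: lattice_identity_def)
  define p where "p = degree A"
  define q where "q = degree B"
  have A0: "A \<noteq> 0" and B0: "B \<noteq> 0" using A B by auto
  have dr: "degree r \<le> p - q"
  proof -
    obtain u where u: "u \<in> S" using S by (metis finite.emptyI ex_in_conv)
    let ?T = "shift_poly (-u) A * shift_poly u B"
    have T: "degree ?T = p + q" using A0 B0
      by (subst degree_mult_eq) (auto simp: p_def q_def pcompose_eq_0_iff)
    have "([:C u:] - r) * ?T = smult (a u) (shift_poly (u + 1) B * shift_poly u B) +
        smult (b u) (shift_poly (1 - u) A * shift_poly (-u) A) - D"
      using lattice_identityD(1)[OF I u] by (simp add: algebra_simps)
    also have "degree \<dots> \<le> 2 * p"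
      using B(2) D
      by (intro degree_diff_le degree_add_le order.trans[OF degree_smult_le] order.trans[OF degree_mult_le])
        (auto simp: p_def)
    finally have "degree (([:C u:] - r) * ?T) \<le> 2 * p" .
    moreover have "degree r \<le> degree ([:C u:] - r) \<or> degree r = 0"
      by (metis degree_add_eq_right degree_minus degree_pCons_0 gr0I le_refl uminus_add_conv_diff add.commute)
    ultimately show ?thesis
      using T A0 B0 B(2) unfolding p_def q_def
      by (cases "[:C u:] - r = 0") (auto simp: degree_mult_eq pcompose_eq_0_iff)
  qed
  have bu: "b u = - coeff r (p - q)" if u: "u \<in> S" for u
  proof -
    let ?T = "shift_poly (-u) A * shift_poly u B"
    have "degree ?T \<le> p + q" by (rule order.trans[OF degree_mult_le]) (simp add: p_def q_def)
    then have "coeff (r * ?T) ((p - q) + (p + q)) = coeff r (p - q) * coeff ?T (p + q)"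
      using dr by (rule coeff_mult_degree_le[rotated])
    moreover have "coeff ?T (p + q) = 1"
      using A B by (subst coeff_mult_degree_le) (auto simp: p_def q_def coeff_shift_top)
    moreover have pq: "(p - q) + (p + q) = p + p" using B(2) by (simp add: p_def q_def)
    ultimately have r: "coeff (r * ?T) (p + p) = coeff r (p - q)" by simp
    have T0: "coeff ?T (p + p) = 0"
      using \<open>degree ?T \<le> p + q\<close> B(2) by (intro coeff_eq_0) (simp add: p_def q_def)
    have D0: "coeff D (p + p) = 0" using B(2) D by (intro coeff_eq_0) (simp add: p_def)
    have B2: "coeff (shift_poly (u + 1) B * shift_poly u B) (p + p) = 0"
      using B(2) by (intro coeff_eq_0 le_less_trans[OF degree_mult_le]) (simp add: p_def)
    have A2: "coeff (shift_poly (1 - u) A * shift_poly (-u) A) (p + p) = 1"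
      using A by (subst coeff_mult_degree_le) (auto simp: p_def coeff_shift_top)
    show ?thesis
      using arg_cong[OF lattice_identityD(1)[OF I u], of "\<lambda>P. coeff P (p + p)"] r T0 D0 B2 A2
      by (simp add: left_diff_distrib)
  qed
  define \<beta> where "\<beta> = - coeff r (p - q)"
  have \<beta>: "\<beta> \<noteq> 0"
  proof -
    obtain u where u: "u \<in> S" using S by (metis finite.emptyI ex_in_conv)
    then show ?thesis using bu[OF u] lattice_identityD(3)[OF I u] by (simp add: \<beta>_def)
  qed
  have "\<not> constant (poly B)" using D by (simp add: constant_degree)
  then obtain t where t: "poly B t = 0" using fundamental_theorem_of_algebra by blast
  have "shift_poly t D = smult \<beta> (shift_poly (t/2) (doubled_product A))"
  proof (rule poly_eqI_infinite)
    show "infinite (uminus ` S)" using S by (auto simp: finite_image_iff inj_on_def)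
    fix u assume "u \<in> uminus ` S"
    then show "poly (shift_poly t D) u = poly (smult \<beta> (shift_poly (t/2) (doubled_product A))) u"
      using lattice_identity_root[OF lattice_identity_swap[OF I] _ t, of u] bu
      by (auto simp: \<beta>_def)
  qed
  then have "degree (shift_poly t D) = degree (smult \<beta> (shift_poly (t/2) (doubled_product A)))"
    by simp
  then show False
    using D B(2) A0 \<beta> by (simp add: degree_doubled_product)
qed

text \<open>The factor \<open>C u - r\<close> multiplies a polynomial of degree exactly 2 deg A, and
  no other term exceeds that degree.\<close>

lemma lattice_identity_parameter_const:
  assumes I: "lattice_identity S A B D r C a b"
    and A: "lead_coeff A = 1" and B: "lead_coeff B = 1" "degree B = degree A"
    and D: "degree D \<le> 2 * degree A"
  shows "degree r = 0"
proof (rule ccontr)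
  assume r: "degree r \<noteq> 0"
  have A0: "A \<noteq> 0" and B0: "B \<noteq> 0" using A B by auto
  obtain u where u: "u \<in> S" using I by (metis lattice_identity_def finite.emptyI ex_in_conv)
  let ?T = "shift_poly (-u) A * shift_poly u B"
  have "([:C u:] - r) * ?T = smult (a u) (shift_poly (u + 1) B * shift_poly u B) +
      smult (b u) (shift_poly (1 - u) A * shift_poly (-u) A) - D"
    using lattice_identityD(1)[OF I u] by (simp add: algebra_simps)
  also have "degree \<dots> \<le> 2 * degree A"
    using B(2) D
    by (intro degree_diff_le degree_add_le order.trans[OF degree_smult_le] order.trans[OF degree_mult_le])
      auto
  finally have "degree (([:C u:] - r) * ?T) \<le> 2 * degree A" .
  moreover have "degree ([:C u:] - r) = degree r"
    using r by (metis degree_add_eq_right degree_minus degree_pCons_0 gr0I uminus_add_conv_diff add.commute)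
  ultimately show False
    using A0 B0 B(2) r
    by (cases "[:C u:] - r = 0") (auto simp: degree_mult_eq pcompose_eq_0_iff)
qed

section \<open>Classification of the solutions of the lattice identity\<close>

text \<open>Here \<open>p\<close> is the common degree of \<open>A\<close> and \<open>B\<close>, and
  \<open>g\<close> is the difference of the second coefficients of B(s + u) and A(s - u), a linear
  function of \<open>u\<close>. The coefficients of degree 2p and 2p - 1 do not involve
  \<open>D\<close>: they give C = a + b and the relation between \<open>a\<close> and
  \<open>b\<close>. The next one is multiplied by \<open>g - p\<close> so that \<open>b\<close> can
  be eliminated.\<close>

lemma lattice_identity_cubic:
  assumes I: "lattice_identity S A B D 0 C a b" and u: "u \<in> S"
    and A: "degree A = Suc (Suc n)" "lead_coeff A = 1"
    and B: "degree B = Suc (Suc n)" "lead_coeff B = 1"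
    and D: "degree D < 2 * n + 3"
  defines "p \<equiv> of_nat n + 2 :: complex"
  defines "A1 \<equiv> coeff A (Suc n)" and "A0 \<equiv> coeff A n" and "B1 \<equiv> coeff B (Suc n)" and "B0 \<equiv> coeff B n"
  defines "g \<equiv> B1 - A1 + 2 * p * u"
  shows "a u * (g + p) = b u * (g - p)"
    and "(g - p) * coeff D (2 * n + 2) =
      a u * (g ^ 3 - p\<^sup>2 * g + ((p - 1) * (B1\<^sup>2 - A1\<^sup>2) - 2 * p * (B0 - A0)))"
proof -
  have sA: "coeff (shift_poly h A) (Suc (Suc n)) = 1"
    "coeff (shift_poly h A) (Suc n) = A1 + p * h"
    "coeff (shift_poly h A) n = A0 + (p - 1) * h * A1 + (p - 1) * p / 2 * h\<^sup>2" for h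
    using A by (simp_all add: coeff_shift_top coeff_shift_second coeff_shift_third A1_def A0_def p_def)
  have sB: "coeff (shift_poly h B) (Suc (Suc n)) = 1"
    "coeff (shift_poly h B) (Suc n) = B1 + p * h"
    "coeff (shift_poly h B) n = B0 + (p - 1) * h * B1 + (p - 1) * p / 2 * h\<^sup>2" for h
    using B by (simp_all add: coeff_shift_top coeff_shift_second coeff_shift_third B1_def B0_def p_def)
  note eq = lattice_identityD(1)[OF I u, unfolded diff_0_right]
  have i: "Suc (Suc n) + Suc (Suc n) = 2 * n + 4" "Suc (Suc n + Suc n) = 2 * n + 3" "Suc (Suc (n + n)) = 2 * n + 2"
    by simp_all
  have c4: "coeff (P * Q) (2 * n + 4) = coeff P (Suc (Suc n)) * coeff Q (Suc (Suc n))"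
    if "degree P \<le> Suc (Suc n)" "degree Q \<le> Suc (Suc n)" for P Q :: "complex poly"
    using coeff_mult_degree_le[OF that] by (simp only: i(1))
  have c3: "coeff (P * Q) (2 * n + 3) = coeff P (Suc (Suc n)) * coeff Q (Suc n) + coeff P (Suc n) * coeff Q (Suc (Suc n))"
    if "degree P \<le> Suc (Suc n)" "degree Q \<le> Suc (Suc n)" for P Q :: "complex poly"
    using coeff_mult_second[OF that] by (simp only: i(2))
  have c2: "coeff (P * Q) (2 * n + 2) = coeff P (Suc (Suc n)) * coeff Q n + coeff P (Suc n) * coeff Q (Suc n)
      + coeff P n * coeff Q (Suc (Suc n))"
    if "degree P \<le> Suc (Suc n)" "degree Q \<le> Suc (Suc n)" for P Q :: "complex poly"
    using coeff_mult_third[OF that] by (simp only: i(3))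
  have D43: "coeff D (2 * n + 4) = 0" "coeff D (2 * n + 3) = 0"
    using D by (auto intro: coeff_eq_0)
  \<comment> \<open>Second and third coefficients of A(s - u) and B(s + u). The remaining two
    factors are unit shifts of these, so \<open>u\<close> enters only through these four
    numbers.\<close>
  define x1 where "x1 = A1 - p * u"
  define y1 where "y1 = B1 + p * u"
  define x2 where "x2 = A0 - (p - 1) * u * A1 + (p - 1) * p / 2 * u\<^sup>2"
  define y2 where "y2 = B0 + (p - 1) * u * B1 + (p - 1) * p / 2 * u\<^sup>2"
  have X: "coeff (shift_poly (-u) A) (Suc n) = x1" "coeff (shift_poly (-u) A) n = x2"
     "coeff (shift_poly (1 - u) A) (Suc n) = x1 + p"
     "coeff (shift_poly (1 - u) A) n = x2 + (p - 1) * x1 + (p - 1) * p / 2"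
    by (simp_all add: sA x1_def x2_def field_simps power2_eq_square)
  have Y: "coeff (shift_poly u B) (Suc n) = y1" "coeff (shift_poly u B) n = y2"
     "coeff (shift_poly (u + 1) B) (Suc n) = y1 + p"
     "coeff (shift_poly (u + 1) B) n = y2 + (p - 1) * y1 + (p - 1) * p / 2"
    by (simp_all add: sB y1_def y2_def field_simps power2_eq_square)
  have e4: "C u = a u + b u"
    using arg_cong[OF eq, of "\<lambda>P. coeff P (2 * n + 4)"] D43 by (simp add: c4 A(1) B(1) sA(1) sB(1))
  have e3: "(a u + b u) * (x1 + y1) = a u * (2 * y1 + p) + b u * (2 * x1 + p)"
  proof -
    have "C u * (y1 + x1) = a u * (y1 + (y1 + p)) + b u * (x1 + (x1 + p))"
      using arg_cong[OF eq, of "\<lambda>P. coeff P (2 * n + 3)"] D43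
      by (simp add: c3 A(1) B(1) sA(1) sB(1) X Y)
    then show ?thesis unfolding e4 by (simp add: algebra_simps)
  qed
  have g: "g = y1 - x1" by (simp add: g_def y1_def x1_def algebra_simps)
  show ab: "a u * (g + p) = b u * (g - p)" using e3 unfolding g by (simp add: algebra_simps)
  define Ea where "Ea = y2 + (p - 1) * y1 + (p - 1) * p / 2 + y2 + y1 * (y1 + p) - (x2 + y2 + x1 * y1)"
  define Eb where "Eb = x2 + (p - 1) * x1 + (p - 1) * p / 2 + x2 + x1 * (x1 + p) - (x2 + y2 + x1 * y1)"
  have e2: "coeff D (2 * n + 2) = a u * Ea + b u * Eb"
  proof -
    have "coeff D (2 * n + 2) + C u * (y2 + x1 * y1 + x2) =
        a u * (y2 + (y1 + p) * y1 + (y2 + (p - 1) * y1 + (p - 1) * p / 2)) +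
        b u * (x2 + (x1 + p) * x1 + (x2 + (p - 1) * x1 + (p - 1) * p / 2))"
      using arg_cong[OF eq, of "\<lambda>P. coeff P (2 * n + 2)"]
      by (simp only: coeff_add coeff_smult mult_pCons_left mult_zero_left add_0_right pCons_0_0 coeff_0
          c2 A(1) B(1) degree_shift_poly order.refl sA(1) sB(1) X Y mult_1_left mult_1_right)
    then show ?thesis unfolding e4 Ea_def Eb_def by (simp add: algebra_simps)
  qed
  have "(g - p) * coeff D (2 * n + 2) = a u * (g - p) * Ea + (b u * (g - p)) * Eb"
    unfolding e2 by (simp add: algebra_simps)
  also have "\<dots> = a u * ((g - p) * Ea + (g + p) * Eb)"
    unfolding ab[symmetric] by (simp add: algebra_simps)
  also have "(g - p) * Ea + (g + p) * Eb =
      g ^ 3 + g * (2 * p - 1) * (x1 + y1) + p * (p - 1) * g - p * (2 * (y2 - x2) + (2 * p - 1) * g + (x1 + y1) * g)"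
    unfolding Ea_def Eb_def g by (simp add: field_simps power3_eq_cube)
  also have "\<dots> = g ^ 3 - p\<^sup>2 * g + (p - 1) * (x1 + y1) * g - 2 * p * (y2 - x2)"
    by (simp add: algebra_simps power2_eq_square)
  also have "x1 + y1 = A1 + B1" by (simp add: x1_def y1_def)
  also have "y2 - x2 = B0 - A0 + (p - 1) * u * (A1 + B1)" by (simp add: x2_def y2_def algebra_simps)
  \<comment> \<open>The part of y2 - x2 that is linear in \<open>u\<close> cancels against the one
    in \<open>(p - 1) * (A1 + B1) * g\<close>; what is left depends on \<open>u\<close> through
    \<open>g\<close> alone.\<close>
  also have "g ^ 3 - p\<^sup>2 * g + (p - 1) * (A1 + B1) * g - 2 * p * (B0 - A0 + (p - 1) * u * (A1 + B1)) =
     g ^ 3 - p\<^sup>2 * g + ((p - 1) * (B1\<^sup>2 - A1\<^sup>2) - 2 * p * (B0 - A0))"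
  proof -
    have "(p - 1) * (A1 + B1) * g = (p - 1) * (A1 + B1) * (B1 - A1) + 2 * p * ((p - 1) * u * (A1 + B1))"
      unfolding g_def by (simp add: algebra_simps)
    then show ?thesis by (simp add: algebra_simps power2_eq_square)
  qed
  finally show "(g - p) * coeff D (2 * n + 2) =
      a u * (g ^ 3 - p\<^sup>2 * g + ((p - 1) * (B1\<^sup>2 - A1\<^sup>2) - 2 * p * (B0 - A0)))" .
qed

text \<open>For degree n + 2 > 2 the coefficient of \<open>D\<close> in degree 2n + 2 is zero, and
  \<open>a u\<close> is not, so a fixed monic cubic would vanish at the infinitely many values of
  \<open>g\<close>. Degree 2 escapes because there 2n + 2 equals deg D.\<close>

lemma lattice_identity_degree_2:
  assumes I: "lattice_identity S A B D 0 C a b"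
    and A: "degree A \<ge> 2" "lead_coeff A = 1"
    and B: "degree B = degree A" "lead_coeff B = 1"
    and D: "degree D = degree A"
  shows "degree A = 2"
proof (rule ccontr)
  assume "degree A \<noteq> 2"
  then obtain n where n: "degree A = Suc (Suc n)" "n > 0"
    using A(1) by (metis One_nat_def Suc_1 not0_implies_Suc not_less_eq_eq le_SucE le0 gr0I)
  define p where "p = (of_nat n + 2 :: complex)"
  have p: "p \<noteq> 0" unfolding p_def by (metis of_nat_add of_nat_eq_0_iff of_nat_numeral add_is_0 zero_neq_numeral)
  define g0 where "g0 = coeff B (Suc n) - coeff A (Suc n)"
  define c where "c = (p - 1) * ((coeff B (Suc n))\<^sup>2 - (coeff A (Suc n))\<^sup>2) - 2 * p * (coeff B n - coeff A n)"
  have "[:c, - p\<^sup>2, 0, 1:] = 0"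
  proof (rule poly_eqI_infinite)
    have "inj (\<lambda>u. g0 + 2 * p * u)" using p by (auto simp: inj_on_def)
    then show "infinite ((\<lambda>u. g0 + 2 * p * u) ` S)"
      using I by (simp add: lattice_identity_def finite_image_iff inj_on_subset)
    fix g assume "g \<in> (\<lambda>u. g0 + 2 * p * u) ` S"
    then obtain u where u: "u \<in> S" and g: "g = g0 + 2 * p * u" by auto
    have "coeff D (2 * n + 2) = 0" using n D by (intro coeff_eq_0) simp
    then have "a u * (g ^ 3 - p\<^sup>2 * g + c) = 0"
      using lattice_identity_cubic(2)[OF I u, of n] n A B D
      by (simp add: g g0_def c_def p_def)
    then have "g ^ 3 - p\<^sup>2 * g + c = 0"
      using lattice_identityD(2)[OF I u] by simp
    then show "poly [:c, - p\<^sup>2, 0, 1:] g = poly 0 g"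
      by (simp add: algebra_simps power3_eq_cube power2_eq_square)
  qed
  then show False by simp
qed

lemma degree_2_explicit:
  assumes "degree p = 2"
  obtains x y z where "p = [:x, y, z:]" "z \<noteq> 0"
proof -
  have "p = [:coeff p 0, coeff p 1, coeff p 2:]"
    using assms by (intro poly_eqI) (auto simp: coeff_pCons numeral_2_eq_2 coeff_eq_0 split: nat.split)
  moreover have "coeff p 2 \<noteq> 0" using assms by (metis leading_coeff_0_iff degree_0 zero_neq_numeral)
  ultimately show ?thesis using that by blast
qed

text \<open>Each coefficient of \<open>D\<close> times \<open>g - 2\<close> equals
  \<open>a u\<close> times a polynomial of degree at most 3 in \<open>g\<close>; cross-multiplying
  with the equation for \<open>d2\<close> removes \<open>a u\<close>. Both resulting relations hold
  for infinitely many \<open>g\<close>, hence coefficientwise: the one for \<open>d1\<close> gives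
  equality of the discriminants \<open>P\<close>, \<open>Q\<close> in degree 2 and the value of
  \<open>d1\<close> in degree 3. The values found for \<open>d1\<close> and \<open>d0\<close> mean
  that D = d2 (s + \<sigma>/4)(s + (\<sigma> + 2)/4).\<close>

lemma lattice_identity_quadratic:
  assumes I: "lattice_identity S [:A0, A1, 1:] [:B0, B1, 1:] [:d0, d1, d2:] 0 C a b" and d2: "d2 \<noteq> 0"
  defines "\<sigma> \<equiv> A1 + B1"
  shows "B1\<^sup>2 - 4 * B0 = A1\<^sup>2 - 4 * A0"
    and "d1 = d2 * (\<sigma> + 1) / 2" "d0 = d2 * \<sigma> * (\<sigma> + 2) / 16"
proof -
  define P where "P = B1\<^sup>2 - 4 * B0"
  define Q where "Q = A1\<^sup>2 - 4 * A0"
  define G where "G = (\<lambda>u. B1 - A1 + 4 * u) ` S"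
  have G: "infinite G"
    using I by (auto simp: G_def lattice_identity_def finite_image_iff inj_on_def)
  have rel: "d1 * (g ^ 3 - 4 * g + (P - Q)) =
      d2 * ((\<sigma> + 1) / 2 * (g ^ 3 - 4 * g) - (P - Q) / 2 * g ^ 2 + (\<sigma> + 2) / 2 * (P - Q)) \<and>
    d0 * (g ^ 3 - 4 * g + (P - Q)) =
      d2 * (\<sigma> * (\<sigma> + 2) / 16 * (g ^ 3 - 4 * g) - (P - Q) * ((2 * \<sigma> + 1) / 16 * g ^ 2
        - (P - Q) / 16 * g - (\<sigma>\<^sup>2 + 4 * \<sigma> + 8 - 2 * (P + Q)) / 16))"
    if "g \<in> G" for g
  proof -
    obtain u where u: "u \<in> S" and g: "g = B1 - A1 + 4 * u" using \<open>g \<in> G\<close> by (auto simp: G_def)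
    define x1 where "x1 = A1 - 2 * u"
    define y1 where "y1 = B1 + 2 * u"
    define x2 where "x2 = A0 - u * A1 + u\<^sup>2"
    define y2 where "y2 = B0 + u * B1 + u\<^sup>2"
    have X: "shift_poly (-u) [:A0, A1, 1:] = [:x2, x1, 1:]"
      "shift_poly (1 - u) [:A0, A1, 1:] = [:x2 + x1 + 1, x1 + 2, 1:]"
      "shift_poly u [:B0, B1, 1:] = [:y2, y1, 1:]"
      "shift_poly (u + 1) [:B0, B1, 1:] = [:y2 + y1 + 1, y1 + 2, 1:]"
      by (simp_all add: pcompose_pCons x1_def x2_def y1_def y2_def algebra_simps power2_eq_square)
    have xs: "x1 = (\<sigma> - g) / 2" "y1 = (\<sigma> + g) / 2"
      by (simp_all add: x1_def y1_def g \<sigma>_def field_simps)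
    \<comment> \<open>Discriminants are invariant under the shifts by \<open>u\<close>, so the
      constant terms are determined by x1, y1 and the fixed numbers \<open>P\<close>,
      \<open>Q\<close>.\<close>
    have x2: "x2 = (x1\<^sup>2 - Q) / 4" "y2 = (y1\<^sup>2 - P) / 4"
      by (simp_all add: x1_def y1_def x2_def y2_def P_def Q_def field_simps power2_eq_square)
    note eq = lattice_identityD(1)[OF I u, unfolded X diff_0_right]
    have C: "C u = a u + b u" using eq by simp
    have gxy: "g = y1 - x1" by (simp add: xs field_simps)
    have e3: "a u * (g + 2) = b u * (g - 2)"
      using eq unfolding C gxy by (simp add: algebra_simps)
    have e2: "d2 = a u * (2 * y2 + y1\<^sup>2 + 3 * y1 + 1 - (x2 + y2 + x1 * y1)) +
                   b u * (2 * x2 + x1\<^sup>2 + 3 * x1 + 1 - (x2 + y2 + x1 * y1))"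
      using eq unfolding C by (simp add: algebra_simps power2_eq_square)
    have e1: "d1 = a u * (2 * y1 * y2 + y1\<^sup>2 + y1 + 2 * y2 - (x1 * y2 + x2 * y1)) +
                   b u * (2 * x1 * x2 + x1\<^sup>2 + x1 + 2 * x2 - (x1 * y2 + x2 * y1))"
      using eq unfolding C by (simp add: algebra_simps power2_eq_square)
    have e0: "d0 = a u * (y2 * (y2 + y1 + 1) - x2 * y2) + b u * (x2 * (x2 + x1 + 1) - x2 * y2)"
      using eq unfolding C by (simp add: algebra_simps power2_eq_square)
    have mul: "(g - 2) * d = a u * ((g - 2) * Ea + (g + 2) * Eb)" if "d = a u * Ea + b u * Eb" for d Ea Eb
    proof -
      have "(g - 2) * d = a u * (g - 2) * Ea + b u * (g - 2) * Eb" using that by (simp add: algebra_simps)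
      then show ?thesis unfolding e3[symmetric] by (simp add: algebra_simps)
    qed
    have f2: "(g - 2) * d2 = a u * (g ^ 3 - 4 * g + (P - Q))"
      unfolding mul[OF e2] x2 xs by (simp add: field_simps power2_eq_square power3_eq_cube)
    have f1: "(g - 2) * d1 =
      a u * ((\<sigma> + 1) / 2 * (g ^ 3 - 4 * g) - (P - Q) / 2 * g ^ 2 + (\<sigma> + 2) / 2 * (P - Q))"
      unfolding mul[OF e1] x2 xs by (simp add: field_simps power2_eq_square power3_eq_cube)
    have f0: "(g - 2) * d0 =
      a u * (\<sigma> * (\<sigma> + 2) / 16 * (g ^ 3 - 4 * g) - (P - Q) * ((2 * \<sigma> + 1) / 16 * g ^ 2
        - (P - Q) / 16 * g - (\<sigma>\<^sup>2 + 4 * \<sigma> + 8 - 2 * (P + Q)) / 16))"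
      unfolding mul[OF e0] x2 xs by (simp add: field_simps power2_eq_square power3_eq_cube)
    have cancel: "d * X = d2 * Y" if "(g - 2) * d = a u * Y" "(g - 2) * d2 = a u * X" for d X Y
    proof -
      have "a u * (d * X) = d * ((g - 2) * d2)" using that(2) by simp
      also have "\<dots> = d2 * ((g - 2) * d)" by simp
      also have "\<dots> = a u * (d2 * Y)" using that(1) by simp
      finally show ?thesis using lattice_identityD(2)[OF I u] by simp
    qed
    show ?thesis using cancel[OF f1 f2] cancel[OF f0 f2] by blast
  qed
  have "[:d1 * (P - Q), - 4 * d1, 0, d1:] =
    [:d2 * ((\<sigma> + 2) / 2 * (P - Q)), - 2 * d2 * (\<sigma> + 1), - d2 * (P - Q) / 2, d2 * (\<sigma> + 1) / 2:]"
    by (rule poly_eqI_infinite[OF G]) (use rel in \<open>auto simp: field_simps power2_eq_square power3_eq_cube\<close>)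
  then have PQ: "P = Q" and d1: "d1 = d2 * (\<sigma> + 1) / 2" using d2 by auto
  show "B1\<^sup>2 - 4 * B0 = A1\<^sup>2 - 4 * A0" using PQ by (simp add: P_def Q_def)
  show "d1 = d2 * (\<sigma> + 1) / 2" by (fact d1)
  have "[:0, - 4 * d0, 0, d0:] = smult (d2 * \<sigma> * (\<sigma> + 2) / 16) [:0, - 4, 0, 1:]"
  proof (rule poly_eqI_infinite[OF G])
    fix g assume "g \<in> G"
    then have "d0 * (g ^ 3 - 4 * g) = d2 * (\<sigma> * (\<sigma> + 2) / 16 * (g ^ 3 - 4 * g))"
      using rel PQ by simp
    moreover have "poly [:0, - 4 * d0, 0, d0:] g = d0 * (g ^ 3 - 4 * g)"
      by (simp add: algebra_simps power3_eq_cube)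
    moreover have "poly (smult (d2 * \<sigma> * (\<sigma> + 2) / 16) [:0, - 4, 0, 1:]) g =
        d2 * (\<sigma> * (\<sigma> + 2) / 16 * (g ^ 3 - 4 * g))"
      by (simp add: field_simps power3_eq_cube)
    ultimately show "poly [:0, - 4 * d0, 0, d0:] g = poly (smult (d2 * \<sigma> * (\<sigma> + 2) / 16) [:0, - 4, 0, 1:]) g"
      by metis
  qed
  then show "d0 = d2 * \<sigma> * (\<sigma> + 2) / 16" by simp
qed

text \<open>Unequal degrees with a maximum of at least 2 are excluded by
  \<open>lattice_identity_not_greater\<close>, applied to the identity or to its swap. In equal
  degree \<open>r\<close> is constant, hence zero by its root -1, and the root -1 of
  \<open>D\<close> selects the two values of \<open>A1 + B1\<close>. The case of linear
  \<open>A\<close> is left for separate treatment.\<close>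

lemma lattice_identity_classification:
  assumes I: "lattice_identity S A B D r C a b"
    and A: "lead_coeff A = 1" "degree A \<ge> 1" and B: "lead_coeff B = 1"
    and D: "D \<noteq> 0" "poly D (-1) = 0" and r: "poly r (-1) = 0"
  obtains "degree A = 1" "degree B \<le> 1"
  | A0 A1 B0 B1 d where "r = 0" "A = [:A0, A1, 1:]" "B = [:B0, B1, 1:]"
      "B1\<^sup>2 - 4 * B0 = A1\<^sup>2 - 4 * A0" "d \<noteq> 0"
      "A1 + B1 = 2 \<and> D = smult d [:1 / 2, 3 / 2, 1:] \<or> A1 + B1 = 4 \<and> D = smult d [:3 / 2, 5 / 2, 1:]"
proof -
  have A0: "A \<noteq> 0" and B0: "B \<noteq> 0" using A B by auto
  have D1: "degree D \<ge> 1"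
  proof (rule ccontr)
    assume "\<not> degree D \<ge> 1"
    then obtain x where "D = [:x:]" by (metis degree_eq_zeroE less_one not_le)
    then show False using D by simp
  qed
  note I' = lattice_identity_swap[OF I]
  have dB: "degree D = degree B" if "degree A \<ge> 2" using lattice_identity_degree[OF I that B0 D1] .
  have dA: "degree D = degree A" if "degree B \<ge> 2" using lattice_identity_degree[OF I' that A0 D1] .
  consider "degree A = 1" "degree B \<le> 1" | "degree B < degree A" "degree A \<ge> 2"
    | "degree A < degree B" "degree B \<ge> 2" | "degree B = degree A" "degree A \<ge> 2"
    using A(2) by linarith
  then show thesis
  proof cases
    case 1
    then show ?thesis using that(1) by blast
  next
    case 2
    then show ?thesis using lattice_identity_not_greater[OF I A(1) B] dB D1 by auto
  next
    case 3
    then show ?thesis using lattice_identity_not_greater[OF I' B A(1)] dA D1 by auto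
  next
    case 4
    have dD: "degree D = degree A" using dB 4 by simp
    have "degree r = 0"
      using lattice_identity_parameter_const[OF I A(1) B] 4 dD by simp
    then obtain x where "r = [:x:]" by (meson degree_eq_zeroE)
    then have r0: "r = 0" using r by simp
    have "degree A = 2"
      using lattice_identity_degree_2[OF I[unfolded r0]] 4 A(1) B dD by simp
    then obtain A0 A1 A2 B0 B1 B2 d0 d1 d2 where *: "A = [:A0, A1, A2:]" "A2 \<noteq> 0"
      "B = [:B0, B1, B2:]" "B2 \<noteq> 0" "D = [:d0, d1, d2:]" "d2 \<noteq> 0"
      using 4 dD by (metis degree_2_explicit)
    have AB: "A = [:A0, A1, 1:]" "B = [:B0, B1, 1:]" using * A(1) B by auto
    note Q = lattice_identity_quadratic[OF I[unfolded r0 AB *(5)] *(6)]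
    define \<sigma> where "\<sigma> = A1 + B1"
    have "d0 - d1 + d2 = 0" using D(2) * by (simp add: algebra_simps)
    \<comment> \<open>The right side is 16 D(-1).\<close>
    moreover have "d2 * ((\<sigma> - 2) * (\<sigma> - 4)) = 16 * (d0 - d1 + d2)"
      unfolding Q(2,3)[folded \<sigma>_def] by (simp add: field_simps)
    ultimately have "d2 * ((\<sigma> - 2) * (\<sigma> - 4)) = 0"
      by simp
    then have "\<sigma> = 2 \<or> \<sigma> = 4" using *(6) by auto
    then have "A1 + B1 = 2 \<and> D = smult d2 [:1 / 2, 3 / 2, 1:] \<or> A1 + B1 = 4 \<and> D = smult d2 [:3 / 2, 5 / 2, 1:]"
      using Q(2,3) * unfolding \<sigma>_def[symmetric] by (auto simp: mult.commute)
    then show ?thesis using that(2)[OF r0 AB Q(1) *(6)] by blast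
  qed
qed

section \<open>Rational sequences and the walk along roots\<close>

lemma infinite_of_nat_diff:
  assumes "finite F"
  shows "infinite ((of_nat :: nat \<Rightarrow> complex) ` (- F))"
  using assms by (simp add: finite_image_iff inj_on_def)

lemma finite_nat_roots:
  fixes p :: "complex poly"
  assumes "p \<noteq> 0"
  shows "finite {k::nat. poly p (of_nat k + h) = 0}"
proof -
  have "finite ((\<lambda>k::nat. of_nat k + h) -` {x. poly p x = 0})"
    using assms by (intro finite_vimageI poly_roots_finite) (auto simp: inj_on_def)
  then show ?thesis by (simp add: vimage_def)
qed

lemma finite_int_roots:
  fixes p :: "complex poly"
  assumes "p \<noteq> 0"
  shows "finite {k::int. poly p (h + of_int k) = 0}"
proof -
  have "finite ((\<lambda>k::int. h + of_int k) -` {x. poly p x = 0})"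
    using assms by (intro finite_vimageI poly_roots_finite) (auto simp: inj_on_def)
  then show ?thesis by (simp add: vimage_def)
qed

section \<open>Hypergeometric terms that are rational in the index\<close>

definition no_common_root :: "complex poly \<Rightarrow> complex poly \<Rightarrow> bool" where
  "no_common_root U V \<longleftrightarrow> (\<forall>z. poly U z \<noteq> 0 \<or> poly V z \<noteq> 0)"

lemma no_common_rootD: "no_common_root U V \<Longrightarrow> poly U z \<noteq> 0 \<or> poly V z \<noteq> 0"
  by (simp add: no_common_root_def)

lemma cancel_common_roots:
  fixes U V :: "complex poly"
  assumes "V \<noteq> 0"
  shows "\<exists>U' V' g. U = U' * g \<and> V = V' * g \<and> no_common_root U' V'"
  using assms
proof (induction "degree V" arbitrary: U V rule: less_induct)
  case less
  show ?case
  proof (cases "\<exists>z. poly U z = 0 \<and> poly V z = 0")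
    case True
    then obtain z U1 V1 where 1: "U = [:- z, 1:] * U1" "V = [:- z, 1:] * V1"
      by (auto simp only: poly_eq_0_iff_dvd dvd_def)
    have V1: "V1 \<noteq> 0" using 1(2) less.prems by auto
    then have "degree V = Suc (degree V1)" unfolding 1(2) by (subst degree_mult_eq) auto
    then obtain U' V' g where "U1 = U' * g" "V1 = V' * g" "no_common_root U' V'"
      using less.hyps[OF _ V1, of U1] by auto
    then have "U = U' * ([:- z, 1:] * g) \<and> V = V' * ([:- z, 1:] * g) \<and>
        no_common_root U' V'"
      unfolding 1 by (simp only: mult_ac simp_thms)
    then show ?thesis by blast
  next
    case False
    then show ?thesis by (intro exI[of _ U] exI[of _ V] exI[of _ 1]) (auto simp: no_common_root_def)
  qed
qed

text \<open>Passing to lowest terms loses only k = 0 and the finitely many zeros of the cancelled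
  factor. The term ratio thus still holds at infinitely many naturals and becomes an identity of
  polynomials, which can be evaluated at any complex point.\<close>

lemma hypergeometric_rational_sequence:
  fixes x :: "nat \<Rightarrow> complex"
  assumes x: "\<And>k. x k \<noteq> 0" "\<And>k. x (Suc k) * poly N (of_nat k) = x k * poly N' (of_nat k)"
    and V: "V \<noteq> 0" and UV: "\<And>k. k \<ge> 1 \<Longrightarrow> x k * poly V (of_nat k) = poly U (of_nat k)"
  obtains U' V' F where "no_common_root U' V'" "U' \<noteq> 0" "V' \<noteq> 0"
    "shift_poly 1 U' * V' * N = U' * shift_poly 1 V' * N'"
    "finite F" "\<And>k. k \<notin> F \<Longrightarrow> x k * poly V' (of_nat k) = poly U' (of_nat k)"
proof -
  obtain U' V' g where U': "U = U' * g" and V': "V = V' * g"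
    and cop: "no_common_root U' V'"
    using cancel_common_roots[OF V] by metis
  have g: "g \<noteq> 0" using V V' by auto
  define F where "F = insert 0 {k::nat. poly g (of_nat k) = 0}"
  have F: "finite F" using finite_nat_roots[OF g, of 0] by (simp add: F_def)
  have F': "x k * poly V' (of_nat k) = poly U' (of_nat k)" if "k \<notin> F" for k
    using UV[of k] that U' V' by (auto simp: F_def)
  define G where "G = F \<union> Suc -` F"
  have G: "finite G" using F by (auto simp: G_def intro: finite_vimageI)
  have V0: "V' \<noteq> 0" using V V' by auto
  have id: "shift_poly 1 U' * V' * N = U' * shift_poly 1 V' * N'"
  proof (rule poly_eqI_infinite[OF infinite_of_nat_diff[OF G]])
    fix z :: complex assume "z \<in> of_nat ` (- G)"
    then obtain k where z: "z = of_nat k" and k: "k \<notin> F" "Suc k \<notin> F" by (auto simp: G_def)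
    show "poly (shift_poly 1 U' * V' * N) z = poly (U' * shift_poly 1 V' * N') z"
    proof -
      have "poly (shift_poly 1 U' * V' * N) z = poly U' (z + 1) * poly V' z * poly N z"
        by simp
      also have "poly U' (z + 1) = x (Suc k) * poly V' (z + 1)"
        using F'[OF k(2)] z by (simp add: add.commute)
      also have "x (Suc k) * poly V' (z + 1) * poly V' z * poly N z =
          (x (Suc k) * poly N z) * poly V' (z + 1) * poly V' z"
        by (simp only: mult_ac)
      also have "x (Suc k) * poly N z = x k * poly N' z"
        using x(2)[of k] z by simp
      also have "x k * poly N' z * poly V' (z + 1) * poly V' z =
          (x k * poly V' z) * poly V' (z + 1) * poly N' z"
        by (simp only: mult_ac)
      also have "x k * poly V' z = poly U' z"
        using F'[OF k(1)] z by simp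
      also have "poly U' z * poly V' (z + 1) * poly N' z = poly (U' * shift_poly 1 V' * N') z"
        by simp
      finally show ?thesis .
    qed
  qed
  have "U' \<noteq> 0"
  proof
    assume "U' = 0"
    then have "V' = 0"
      using F' x(1) by (intro poly_eqI_infinite[OF infinite_of_nat_diff[OF F]]) auto
    then show False using V0 by simp
  qed
  then show ?thesis using that[OF cop _ V0 id F] F' by blast
qed

text \<open>Take the last zero w of \<open>V\<close> among z, z + 1, and so on. There
  \<open>U\<close> does not vanish and neither does V(w + 1), so the identity at w leaves N'(w) =
  0.\<close>

lemma pole_propagates:
  fixes U V :: "complex poly"
  assumes cop: "no_common_root U V" and V: "V \<noteq> 0"
    and id: "shift_poly 1 U * V * N = U * shift_poly 1 V * N'" and z: "poly V z = 0"
  shows "\<exists>j::nat. poly N' (z + of_nat j) = 0"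
proof -
  have "\<exists>j. poly V (z + of_nat j) = 0 \<and> poly V (z + of_nat (Suc j)) \<noteq> 0"
  proof (rule ccontr)
    assume *: "\<not> ?thesis"
    have "poly V (z + of_nat j) = 0" for j
      by (induction j) (use * z in auto)
    then have "{k::nat. poly V (of_nat k + z) = 0} = UNIV" by (auto simp: add.commute)
    then show False using finite_nat_roots[OF V, of z] by simp
  qed
  then obtain j where j: "poly V (z + of_nat j) = 0" "poly V (z + of_nat (Suc j)) \<noteq> 0" by blast
  have "poly U (z + of_nat j) \<noteq> 0" using no_common_rootD[OF cop] j by blast
  then have "poly N' (z + of_nat j) = 0"
    using arg_cong[OF id, of "\<lambda>p. poly p (z + of_nat j)"] j by (simp add: add_ac)
  then show ?thesis by blast
qed

text \<open>If V(z) were nonzero, the identity at z would give U(z + 1) = 0. A zero of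
  \<open>U\<close> is not one of \<open>V\<close>, and \<open>N\<close> has no zero further right,
  so the zero of \<open>U\<close> would be passed on to z + 2, z + 3, and so on without end.\<close>

lemma pole_at_last_root:
  fixes U V :: "complex poly"
  assumes cop: "no_common_root U V" and U: "U \<noteq> 0"
    and id: "shift_poly 1 U * V * N = U * shift_poly 1 V * N'" and z: "poly N' z = 0"
    and N: "\<And>i::nat. poly N (z + of_nat i) \<noteq> 0"
  shows "poly V z = 0"
proof (rule ccontr)
  assume V: "poly V z \<noteq> 0"
  have "poly U (z + of_nat (Suc i)) = 0" for i
  proof (induction i)
    case 0
    show ?case using arg_cong[OF id, of "\<lambda>p. poly p z"] N[of 0] z V by simp
  next
    case (Suc i)
    have "poly V (z + of_nat (Suc i)) \<noteq> 0" using no_common_rootD[OF cop] Suc by blast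
    then show ?case
      using arg_cong[OF id, of "\<lambda>p. poly p (z + of_nat (Suc i))"] N[of "Suc i"] Suc
      by (simp add: add_ac)
  qed
  then have "{k::nat. poly U (of_nat k + (z + 1)) = 0} = UNIV" by (auto simp: add_ac)
  then show False using finite_nat_roots[OF U, of "z + 1"] by simp
qed

text \<open>
  For a fixed value of \<open>u\<close>, \<open>N0\<close>, \<open>Np\<close>, \<open>Nm\<close> are the specialisations of the numerator at
  \<open>u\<close>, \<open>u + 1\<close>, \<open>u - 1\<close>, and \<open>x k\<close>, \<open>y k\<close> are the two nontrivial terms of the recurrence,
  normalised by the coefficient with index \<open>k\<close>.
\<close>

definition recurrence_at ::
  "complex poly \<Rightarrow> complex poly \<Rightarrow> complex poly \<Rightarrow> complex poly \<Rightarrow> bool" where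
  "recurrence_at D N0 Np Nm \<longleftrightarrow> Np \<noteq> Nm \<and> N0 \<noteq> 0 \<and> (\<forall>z. poly N0 z = 0 \<longrightarrow> poly D z \<noteq> 0) \<and>
    (\<exists>x y E. \<forall>k::nat. x k \<noteq> 0 \<and> y k \<noteq> 0 \<and>
        x (Suc k) * poly N0 (of_nat k) = x k * poly Np (of_nat k) \<and>
        y (Suc k) * poly N0 (of_nat k) = y k * poly Nm (of_nat k) \<and>
        poly N0 (of_nat k) * (x (Suc k) + y (Suc k)) = poly D (of_nat k) + poly (N0 * E) (of_nat k))"

lemma recurrence_at_swap:
  assumes "recurrence_at D N0 Np Nm"
  shows "recurrence_at D N0 Nm Np"
proof -
  from assms obtain x y E where "\<forall>k::nat. x k \<noteq> 0 \<and> y k \<noteq> 0 \<and>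
        x (Suc k) * poly N0 (of_nat k) = x k * poly Np (of_nat k) \<and>
        y (Suc k) * poly N0 (of_nat k) = y k * poly Nm (of_nat k) \<and>
        poly N0 (of_nat k) * (x (Suc k) + y (Suc k)) = poly D (of_nat k) + poly (N0 * E) (of_nat k)"
    unfolding recurrence_at_def by blast
  then have "\<forall>k::nat. y k \<noteq> 0 \<and> x k \<noteq> 0 \<and>
        y (Suc k) * poly N0 (of_nat k) = y k * poly Nm (of_nat k) \<and>
        x (Suc k) * poly N0 (of_nat k) = x k * poly Np (of_nat k) \<and>
        poly N0 (of_nat k) * (y (Suc k) + x (Suc k)) = poly D (of_nat k) + poly (N0 * E) (of_nat k)"
    by (simp add: add.commute)
  then show ?thesis
    using assms unfolding recurrence_at_def by blast
qed

text \<open>Two linear equations for \<open>x k\<close> and \<open>y k\<close>: the one at index k,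
  where the term ratios turn the left side into x k * Np + y k * Nm, and the one at k - 1, which
  gives their sum times N0(k - 1). The determinant (Np - Nm) N0(s - 1) is a nonzero polynomial, so
  Cramer's rule makes both terms rational. The last identity is the equation at k - 1 in lowest
  terms.\<close>

lemma recurrence_at_rational:
  assumes "recurrence_at D N0 Np Nm"
  obtains U V U' V' E where
    "no_common_root U V" "U \<noteq> 0" "V \<noteq> 0" "shift_poly 1 U * V * N0 = U * shift_poly 1 V * Np"
    "no_common_root U' V'" "U' \<noteq> 0" "V' \<noteq> 0" "shift_poly 1 U' * V' * N0 = U' * shift_poly 1 V' * Nm"
    "(U * V' + U' * V) * shift_poly (-1) N0 = shift_poly (-1) (D + N0 * E) * (V * V')"
proof -
  from assms have ne: "Np \<noteq> Nm" and N0: "N0 \<noteq> 0" by (simp_all add: recurrence_at_def)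
  from assms obtain x y E where "\<forall>k::nat. x k \<noteq> 0 \<and> y k \<noteq> 0 \<and>
        x (Suc k) * poly N0 (of_nat k) = x k * poly Np (of_nat k) \<and>
        y (Suc k) * poly N0 (of_nat k) = y k * poly Nm (of_nat k) \<and>
        poly N0 (of_nat k) * (x (Suc k) + y (Suc k)) = poly D (of_nat k) + poly (N0 * E) (of_nat k)"
    unfolding recurrence_at_def by blast
  then have xy: "\<And>k. x k \<noteq> 0" "\<And>k. y k \<noteq> 0"
    "\<And>k. x (Suc k) * poly N0 (of_nat k) = x k * poly Np (of_nat k)"
    "\<And>k. y (Suc k) * poly N0 (of_nat k) = y k * poly Nm (of_nat k)"
    "\<And>k. poly N0 (of_nat k) * (x (Suc k) + y (Suc k)) = poly (D + N0 * E) (of_nat k)"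
    by simp_all
  define W where "W = D + N0 * E"
  define V where "V = (Np - Nm) * shift_poly (-1) N0"
  have V: "V \<noteq> 0" using ne N0 by (auto simp: V_def pcompose_eq_0_iff)
  define Ux where "Ux = W * shift_poly (-1) N0 - Nm * shift_poly (-1) W"
  define Uy where "Uy = Np * shift_poly (-1) W - W * shift_poly (-1) N0"
  have w: "x k * poly Np (of_nat k) + y k * poly Nm (of_nat k) = poly W (of_nat k)" for k
    using xy(3)[of k] xy(4)[of k] xy(5)[of k] by (simp add: W_def algebra_simps)
  have w': "poly N0 (of_nat k - 1) * (x k + y k) = poly W (of_nat k - 1)" if "k \<ge> 1" for k
    using xy(5)[of "k - 1"] that by (cases k) (simp_all add: W_def)
  have "x k * poly V (of_nat k) = poly Ux (of_nat k)" if "k \<ge> 1" for k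
    by (simp add: V_def Ux_def w[symmetric] w'[OF that, symmetric] algebra_simps)
  from hypergeometric_rational_sequence[OF xy(1,3) V this]
  obtain U1 V1 F1 where 1: "no_common_root U1 V1" "U1 \<noteq> 0" "V1 \<noteq> 0"
    "shift_poly 1 U1 * V1 * N0 = U1 * shift_poly 1 V1 * Np"
    "finite F1" "\<And>k. k \<notin> F1 \<Longrightarrow> x k * poly V1 (of_nat k) = poly U1 (of_nat k)" by blast
  have "y k * poly V (of_nat k) = poly Uy (of_nat k)" if "k \<ge> 1" for k
    by (simp add: V_def Uy_def w[symmetric] w'[OF that, symmetric] algebra_simps)
  from hypergeometric_rational_sequence[OF xy(2,4) V this]
  obtain U2 V2 F2 where 2: "no_common_root U2 V2" "U2 \<noteq> 0" "V2 \<noteq> 0"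
    "shift_poly 1 U2 * V2 * N0 = U2 * shift_poly 1 V2 * Nm"
    "finite F2" "\<And>k. k \<notin> F2 \<Longrightarrow> y k * poly V2 (of_nat k) = poly U2 (of_nat k)" by blast
  have fin: "finite ({0} \<union> F1 \<union> F2)" using 1 2 by simp
  have "(U1 * V2 + U2 * V1) * shift_poly (-1) N0 = shift_poly (-1) W * (V1 * V2)"
  proof (rule poly_eqI_infinite[OF infinite_of_nat_diff[OF fin]])
    fix z :: complex assume "z \<in> of_nat ` (- ({0} \<union> F1 \<union> F2))"
    then obtain k where z: "z = of_nat k" and k: "k \<ge> 1" "k \<notin> F1" "k \<notin> F2" by fastforce
    show "poly ((U1 * V2 + U2 * V1) * shift_poly (-1) N0) z = poly (shift_poly (-1) W * (V1 * V2)) z"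
      using w'[OF k(1), symmetric] 1(6)[OF k(2), symmetric] 2(6)[OF k(3), symmetric] z
      by (simp add: algebra_simps)
  qed
  then show ?thesis using that 1 2 unfolding W_def by blast
qed

text \<open>Shifts keep leading coefficients, so those of \<open>U\<close> and \<open>V\<close>
  cancel from the term ratio identity. This later shows that a factor of the numerator depending on
  \<open>u\<close> alone is constant.\<close>

lemma recurrence_at_lead_coeff:
  assumes "recurrence_at D N0 Np Nm"
  shows "lead_coeff Np = lead_coeff N0"
proof -
  obtain U V where
    UV: "U \<noteq> 0" "V \<noteq> 0" "shift_poly 1 U * V * N0 = U * shift_poly 1 V * Np"
    using assms by (rule recurrence_at_rational)
  have "lead_coeff (shift_poly 1 U * V * N0) = lead_coeff (U * shift_poly 1 V * Np)" using UV(3) by simp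
  then show ?thesis using UV(1,2) by (simp add: lead_coeff_mult coeff_shift_top)
qed

text \<open>At s = z + 1 the left side of the sum equation vanishes, while \<open>D + N0 * E\<close>
  has the value D(z), which is nonzero. Hence one of the two terms has a pole at z + 1, and poles
  propagate to the right up to a root of \<open>Np\<close> or \<open>Nm\<close>.\<close>

lemma recurrence_at_root_right:
  assumes R: "recurrence_at D N0 Np Nm" and z: "poly N0 z = 0"
  shows "\<exists>j::nat. poly Np (z + 1 + of_nat j) = 0 \<or> poly Nm (z + 1 + of_nat j) = 0"
proof -
  obtain U V U' V' E where
    *: "no_common_root U V" "U \<noteq> 0" "V \<noteq> 0" "shift_poly 1 U * V * N0 = U * shift_poly 1 V * Np"
    "no_common_root U' V'" "U' \<noteq> 0" "V' \<noteq> 0" "shift_poly 1 U' * V' * N0 = U' * shift_poly 1 V' * Nm"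
    "(U * V' + U' * V) * shift_poly (-1) N0 = shift_poly (-1) (D + N0 * E) * (V * V')"
    using R by (rule recurrence_at_rational)
  have "poly D z \<noteq> 0" using R z by (auto simp: recurrence_at_def)
  then have "poly V (z + 1) = 0 \<or> poly V' (z + 1) = 0"
    using arg_cong[OF *(9), of "\<lambda>p. poly p (z + 1)"] z by simp
  then show ?thesis
    using pole_propagates[OF *(1,3,4)] pole_propagates[OF *(5,7,8)] by blast
qed

text \<open>If \<open>N0\<close> has no root at z or further right in the progression, then
  \<open>x\<close> has a pole at z. In the sum equation this pole must come from N0(s - 1) or be
  matched by a pole of \<open>y\<close>, and the latter propagates to a root of
  \<open>Nm\<close>.\<close>

lemma recurrence_at_root_left:
  assumes R: "recurrence_at D N0 Np Nm" and z: "poly Np z = 0"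
  shows "poly N0 (z - 1) = 0 \<or> (\<exists>j::nat. poly N0 (z + of_nat j) = 0 \<or> poly Nm (z + of_nat j) = 0)"
proof -
  obtain U V U' V' E where
    *: "no_common_root U V" "U \<noteq> 0" "V \<noteq> 0" "shift_poly 1 U * V * N0 = U * shift_poly 1 V * Np"
    "no_common_root U' V'" "U' \<noteq> 0" "V' \<noteq> 0" "shift_poly 1 U' * V' * N0 = U' * shift_poly 1 V' * Nm"
    "(U * V' + U' * V) * shift_poly (-1) N0 = shift_poly (-1) (D + N0 * E) * (V * V')"
    using R by (rule recurrence_at_rational)
  show ?thesis
  proof (cases "\<exists>j::nat. poly N0 (z + of_nat j) = 0")
    case False
    then have V: "poly V z = 0" using pole_at_last_root[OF *(1,2,4) z] by blast
    then have "poly U z \<noteq> 0" using no_common_rootD[OF *(1)] by blast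
    then have "poly V' z = 0 \<or> poly N0 (z - 1) = 0"
      using arg_cong[OF *(9), of "\<lambda>p. poly p z"] V by auto
    then show ?thesis using pole_propagates[OF *(5,7,8)] by blast
  qed blast
qed

text \<open>The induction carries that \<open>Z n\<close> lies strictly to the left of the maximum
  of \<open>Z (n + 1)\<close>. This prevents turning back: the root found to the right of that
  maximum must belong to \<open>Z (n + 2)\<close>, and tracing the maximum of
  \<open>Z (n + 2)\<close> to the left can only end one unit away, in \<open>Z (n + 1)\<close>. So
  the maximum moves by exactly one.\<close>

lemma root_walk_aux:
  fixes N :: "int \<Rightarrow> complex poly"
  assumes R: "\<And>i. recurrence_at D (N i) (N (i + 1)) (N (i - 1))"
    and m0: "\<And>m. poly (N 0) (\<alpha> + of_int m) = 0 \<Longrightarrow> m \<le> m0"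
    and m1: "m1 > m0" "poly (N 1) (\<alpha> + of_int m1) = 0"
  shows "\<exists>m::int. \<forall>n::nat. poly (N (1 + int n)) (\<alpha> + of_int (m + int n)) = 0"
proof -
  define Z where "Z i = {m::int. poly (N i) (\<alpha> + of_int m) = 0}" for i
  have fin: "finite (Z i)" for i
    using R[of i] unfolding Z_def by (intro finite_int_roots) (simp add: recurrence_at_def)
  have step: "Z (1 + int n) \<noteq> {} \<and> (\<forall>m\<in>Z (int n). m < Max (Z (1 + int n))) \<and>
     Max (Z (1 + int n)) = Max (Z 1) + int n" for n
  proof (induction n)
    case 0
    have "m1 \<in> Z 1" using m1 by (simp add: Z_def)
    then have "m1 \<le> Max (Z 1)" using fin by simp
    then show ?case using \<open>m1 \<in> Z 1\<close> m0 m1(1) by (fastforce simp: Z_def)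
  next
    case (Suc n)
    define M where "M = Max (Z (1 + int n))"
    have M: "M \<in> Z (1 + int n)" unfolding M_def using Suc fin by (intro Max_in) auto
    have below: "m < M" if "m \<in> Z (int n)" for m using Suc that unfolding M_def by blast
    have top: "m \<le> M" if "m \<in> Z (1 + int n)" for m using that fin by (simp add: M_def)
    obtain j :: nat where "M + 1 + int j \<in> Z (2 + int n) \<or> M + 1 + int j \<in> Z (int n)"
      using recurrence_at_root_right[OF R[of "1 + int n"], of "\<alpha> + of_int M"] M
      by (auto simp: Z_def add_ac)
    then have j: "M + 1 + int j \<in> Z (2 + int n)" using below by fastforce
    define M' where "M' = Max (Z (2 + int n))"
    have M': "M' \<in> Z (2 + int n)" using j fin Max_in unfolding M'_def by blast
    have "M' \<ge> M + 1 + int j" using j fin by (simp add: M'_def)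
    moreover have "M' - 1 \<in> Z (1 + int n) \<or> (\<exists>i::nat. M' + int i \<in> Z (1 + int n) \<or> M' + int i \<in> Z (int n))"
      using recurrence_at_root_left[OF R[of "1 + int n"], of "\<alpha> + of_int M'"] M'
      by (auto simp: Z_def add_ac add_diff_eq)
    ultimately have "M' = M + 1" using top below by fastforce
    then have max: "Max (Z (2 + int n)) = M + 1" by (simp add: M'_def)
    have M1: "M = Max (Z 1) + int n" using Suc by (simp add: M_def)
    have e: "1 + int (Suc n) = 2 + int n" "int (Suc n) = 1 + int n" by simp_all
    have "\<forall>m\<in>Z (1 + int n). m < M + 1" using top by fastforce
    then show ?case unfolding e(1) unfolding e(2) max using j M1 by auto
  qed
  have "Max (Z 1) + int n \<in> Z (1 + int n)" for n
  proof -
    have "Max (Z (1 + int n)) \<in> Z (1 + int n)" using step[of n] fin by (intro Max_in) auto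
    then show ?thesis using step[of n] by simp
  qed
  then show ?thesis by (auto simp: Z_def intro!: exI[of _ "Max (Z 1)"])
qed

text \<open>The rightmost root of \<open>N 0\<close> in the coset forces a root strictly further
  right for \<open>N 1\<close> or \<open>N (-1)\<close>, and this decides the direction; the second
  direction is the first one after reflecting the index. The integer \<open>m\<close> absorbs the
  passage from \<alpha> to the rightmost roots.\<close>

lemma root_walk:
  fixes N :: "int \<Rightarrow> complex poly"
  assumes R: "\<And>i. recurrence_at D (N i) (N (i + 1)) (N (i - 1))"
    and \<alpha>: "poly (N 0) \<alpha> = 0"
  obtains m :: int where "\<And>n::nat. poly (N (1 + int n)) (\<alpha> + of_int (m + int n)) = 0"
    | m :: int where "\<And>n::nat. poly (N (- 1 - int n)) (\<alpha> + of_int (m + int n)) = 0"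
proof -
  define Z where "Z = {m::int. poly (N 0) (\<alpha> + of_int m) = 0}"
  have fin: "finite Z"
    using R[of 0] unfolding Z_def by (intro finite_int_roots) (simp add: recurrence_at_def)
  define M where "M = Max Z"
  have "0 \<in> Z" using \<alpha> by (simp add: Z_def)
  then have "M \<in> Z" using fin unfolding M_def by (intro Max_in) auto
  have M: "m \<le> M" if "poly (N 0) (\<alpha> + of_int m) = 0" for m using that fin by (simp add: Z_def M_def)
  obtain j :: nat where "poly (N 1) (\<alpha> + of_int (M + 1 + int j)) = 0 \<or> poly (N (-1)) (\<alpha> + of_int (M + 1 + int j)) = 0"
    using recurrence_at_root_right[OF R[of 0], of "\<alpha> + of_int M"] \<open>M \<in> Z\<close> by (auto simp: Z_def add_ac)
  then show thesis
  proof
    assume *: "poly (N 1) (\<alpha> + of_int (M + 1 + int j)) = 0"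
    show thesis using root_walk_aux[of D N, OF R M _ *] that(1) by auto
  next
    assume *: "poly (N (-1)) (\<alpha> + of_int (M + 1 + int j)) = 0"
    have R': "recurrence_at D (N (- i)) (N (- (i + 1))) (N (- (i - 1)))" for i
    proof -
      have "- (i + 1) = - i - 1" "- (i - 1) = - i + 1" by simp_all
      then show ?thesis using recurrence_at_swap[OF R[of "- i"]] by (simp only:)
    qed
    show thesis
      using root_walk_aux[of D "\<lambda>i. N (- i)" \<alpha> M "M + 1 + int j", OF R'] M * that(2) by auto
  qed
qed

section \<open>Factorization of the numerator\<close>

lemma infinite_compl_countable:
  fixes B :: "complex set"
  assumes "countable B"
  shows "infinite (- B)"
proof
  assume "finite (- B)"
  then have "countable (B \<union> - B)" using countable_Un[OF assms countable_finite] by blast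
  then show False using uncountable_UNIV_complex by (simp only: Compl_partition)
qed

lemma poly_poly_eq_eval2: "poly (poly F p) y = eval2 F (poly p y) y"
  unfolding eval2_def by (induction F) simp_all

lemma eval2_mult [simp]: "eval2 (F * G) x y = eval2 F x y * eval2 G x y"
  by (simp add: eval2_def)

lemma eval2_eq_poly:
  obtains f where "\<And>x. eval2 F x y = poly f x"
proof -
  have "\<exists>f. \<forall>x. eval2 F x y = poly f x"
  proof (induction F)
    case 0
    show ?case by (intro exI[of _ 0]) (simp add: eval2_def)
  next
    case (pCons a F)
    then obtain f where "\<forall>x. eval2 F x y = poly f x" by blast
    then have "\<forall>x. eval2 (pCons a F) x y = poly (pCons (poly a y) f) x"
      by (simp add: eval2_def)
    then show ?case by blast
  qed
  then show ?thesis using that by blast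
qed

lemma poly_periodic_const:
  fixes q :: "complex poly"
  assumes "infinite S" "h \<noteq> 0" "\<And>u. u \<in> S \<Longrightarrow> poly q (u + h) = poly q u"
  shows "q = [:poly q 0:]"
proof -
  have q: "shift_poly h q = q" using assms(3) by (intro poly_eqI_infinite[OF assms(1)]) simp
  have "poly q (of_nat n * h) = poly q 0" for n
  proof (induction n)
    case (Suc n)
    have "poly q (of_nat (Suc n) * h) = poly (shift_poly h q) (of_nat n * h)"
      by (simp add: algebra_simps)
    then show ?case using Suc q by simp
  qed simp
  moreover have "infinite (range (\<lambda>n::nat. of_nat n * h))"
    using assms(2) by (intro range_inj_infinite) (auto simp: inj_def)
  ultimately show ?thesis by (intro poly_eqI_infinite) auto
qed

text \<open>\<open>poly F [:- g / e, 1 / e:]\<close> is the restriction of \<open>F\<close> to the line \<open>s = e * u + g\<close>, parametrized by \<open>s\<close>.\<close>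

lemma eval2_line_factor:
  fixes F :: "complex poly poly"
  assumes "infinite S" "\<And>u. u \<in> S \<Longrightarrow> eval2 F u (e * u + g) = 0" "e \<noteq> 0"
  shows "poly F [:- g / e, 1 / e:] = 0"
proof (rule poly_eqI_infinite)
  show "infinite ((\<lambda>u. e * u + g) ` S)"
    using assms(1,3) by (auto simp: finite_image_iff inj_on_def)
  fix s assume "s \<in> (\<lambda>u. e * u + g) ` S"
  then show "poly (poly F [:- g / e, 1 / e:]) s = poly 0 s"
    using assms(2,3) by (auto simp: poly_poly_eq_eval2 field_simps)
qed

text \<open>Each step of the walk changes the parameter by \<open>e\<close> and the root by 1, so
  all its points lie on one line of slope \<open>e\<close>. Infinitely many zeros on a line put the
  whole line into the zero set of \<open>N\<close>. The point \<alpha> lies on it only up to the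
  integer \<open>j\<close>, since the walk follows a rightmost root of the coset.\<close>

lemma root_on_line:
  fixes N :: "complex poly poly"
  assumes R: "\<And>i::int. recurrence_at d (poly N [:u + of_int i:]) (poly N [:u + of_int i + 1:]) (poly N [:u + of_int i - 1:])"
    and \<alpha>: "eval2 N u \<alpha> = 0"
  obtains e g and j :: int where "e \<in> {1, -1}" "poly N [:- g / e, 1 / e:] = 0" "\<alpha> = e * u + g + of_int j"
proof -
  have R': "recurrence_at d (poly N [:u + of_int i:]) (poly N [:u + of_int (i + 1):]) (poly N [:u + of_int (i - 1):])" for i
    using R[of i] by (simp add: algebra_simps)
  have \<alpha>': "poly (poly N [:u + of_int 0:]) \<alpha> = 0" using \<alpha> by (simp add: eval2_def)
  have inf: "infinite (range (\<lambda>n::nat. c + e * of_nat n :: complex))" if "e \<in> {1, -1}" for c e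
    using that by (intro range_inj_infinite) (auto simp: inj_def)
  from root_walk[of d "\<lambda>i. poly N [:u + of_int i:]", OF R' \<alpha>'] show thesis
  proof cases
    case (1 m)
    have "poly N [:- (\<alpha> + of_int m - u - 1) / 1, 1 / 1:] = 0"
    proof (rule eval2_line_factor[OF inf[of 1 "u + 1"]])
      fix v assume "v \<in> range (\<lambda>n::nat. u + 1 + 1 * of_nat n)"
      then show "eval2 N v (1 * v + (\<alpha> + of_int m - u - 1)) = 0"
        using 1 by (auto simp: eval2_def algebra_simps)
    qed auto
    then show ?thesis by (rule that[of 1 _ "1 - m", rotated]) simp_all
  next
    case (2 m)
    have "poly N [:- (\<alpha> + of_int m + u - 1) / (-1), 1 / (-1):] = 0"
    proof (rule eval2_line_factor[OF inf[of "-1" "u - 1"]])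
      fix v assume "v \<in> range (\<lambda>n::nat. u - 1 + (-1) * of_nat n)"
      then show "eval2 N v ((-1) * v + (\<alpha> + of_int m + u - 1)) = 0"
        using 2 by (auto simp: eval2_def algebra_simps)
    qed auto
    then show ?thesis by (rule that[of "-1" _ "1 - m", rotated]) simp_all
  qed
qed

text \<open>As many line factors as possible are split off, by minimizing the
  \<open>u\<close>-degree of the cofactor \<open>Q\<close>. For good \<open>u\<close> every root of
  \<open>Q\<close> lies on an integer translate of one of the finitely many lines of
  \<open>N\<close>. There are countably many such translates, and \<open>Q\<close> vanishes
  identically on none, so each accounts for finitely many \<open>u\<close>. Outside a countable set
  \<open>Q\<close> thus has no root in \<open>s\<close> and is constant in \<open>s\<close>; being
  1-periodic in \<open>u\<close> by the leading coefficients, it is a constant.\<close>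

lemma lattice_factorization:
  fixes N :: "complex poly poly"
  assumes bad: "countable Bad"
    and R: "\<And>u. u \<notin> Bad \<Longrightarrow> recurrence_at d (poly N [:u:]) (poly N [:u + 1:]) (poly N [:u - 1:])"
  obtains \<kappa> A B where "\<kappa> \<noteq> 0" "lead_coeff A = 1" "lead_coeff B = 1"
    "\<And>u s. eval2 N u s = \<kappa> * poly A (s - u) * poly B (s + u)"
proof -
  \<comment> \<open>The walk visits \<open>u + i\<close> for every integer \<open>i\<close>, so all
    integer translates of \<open>Bad\<close> are excluded; their union is still countable.\<close>
  define Bad' where "Bad' = (\<Union>i::int. (\<lambda>u. u - of_int i) ` Bad)"
  have bad': "countable Bad'" using bad by (auto simp: Bad'_def)
  have Bad': "u + of_int i \<notin> Bad" if "u \<notin> Bad'" for u i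
  proof
    assume "u + of_int i \<in> Bad"
    then have "u \<in> (\<lambda>u. u - of_int i) ` Bad" by (auto intro!: image_eqI[of _ _ "u + of_int i"])
    then show False using that by (auto simp: Bad'_def)
  qed
  obtain u0 where u0: "u0 \<notin> Bad" using infinite_compl_countable[OF bad] by (metis ComplD ex_in_conv finite.emptyI)
  have N0: "N \<noteq> 0" using R[OF u0] by (auto simp: recurrence_at_def)
  define dec where "dec = (\<lambda>(A, B, Q). A \<noteq> 0 \<and> B \<noteq> 0 \<and>
    (\<forall>u s. eval2 N u s = poly A (s - u) * poly B (s + u) * eval2 Q u s))"
  have "dec (1, 1, N)" by (simp add: dec_def)
  then obtain T where T: "dec T" and min: "\<And>T'. dec T' \<Longrightarrow> degree (snd (snd T)) \<le> degree (snd (snd T'))"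
    using ex_has_least_nat[of dec "(1, 1, N)" "\<lambda>T. degree (snd (snd T))"] by blast
  obtain A B Q where TABQ: "T = (A, B, Q)" by (metis surj_pair)
  have A: "A \<noteq> 0" and B: "B \<noteq> 0" and N: "\<And>u s. eval2 N u s = poly A (s - u) * poly B (s + u) * eval2 Q u s"
    using T by (simp_all add: dec_def TABQ)
  have Q0: "Q \<noteq> 0"
  proof
    assume "Q = 0"
    then have "eval2 N u s = 0" for u s using N by (simp add: eval2_def)
    then have "poly N [:u:] = 0" for u by (intro poly_eqI_infinite[OF infinite_UNIV_char_0]) (simp add: eval2_def)
    then show False using R[OF u0] by (simp add: recurrence_at_def)
  qed
  have noline: "poly Q [:- g / e, 1 / e:] \<noteq> 0" if e: "e \<in> {1, -1}" for e g
  proof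
    assume "poly Q [:- g / e, 1 / e:] = 0"
    then obtain Q' where Q': "Q = [:- [:- g / e, 1 / e:], 1:] * Q'" by (auto simp: poly_eq_0_iff_dvd)
    have deg: "degree Q = Suc (degree Q')"
      unfolding Q' using Q0 Q' by (subst degree_mult_eq) auto
    have eQ: "eval2 Q u s = (u + (g - s) / e) * eval2 Q' u s" for u s
      unfolding Q' eval2_mult by (simp add: eval2_def diff_divide_distrib)
    have "\<exists>A' B'. dec (A', B', Q')"
    proof (cases "e = 1")
      case True
      have "poly A (s - u) * poly B (s + u) * eval2 Q u s =
          poly (A * [:g, -1:]) (s - u) * poly B (s + u) * eval2 Q' u s" for u s
        unfolding eQ poly_mult using True by simp
      then have "dec (A * [:g, -1:], B, Q')"
        using A B unfolding dec_def N by (simp del: mult_pCons_right)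
      then show ?thesis by blast
    next
      case False
      then have "e = -1" using e by simp
      then have "poly A (s - u) * poly B (s + u) * eval2 Q u s =
          poly A (s - u) * poly (B * [:- g, 1:]) (s + u) * eval2 Q' u s" for u s
        unfolding eQ poly_mult by simp
      then have "dec (A, B * [:- g, 1:], Q')"
        using A B unfolding dec_def N by (simp del: mult_pCons_right)
      then show ?thesis by blast
    qed
    then obtain A' B' where "dec (A', B', Q')" by blast
    then show False using min TABQ deg by fastforce
  qed
  \<comment> \<open>Lines of slope 1 or -1 in the zero set of \<open>N\<close> correspond to roots
    of \<open>N\<close> as a polynomial in \<open>u\<close> over C[s], whence finiteness.\<close>
  define K where "K = {(e, g). e \<in> {1, -1} \<and> poly N [:- g / e, 1 / e:] = 0}"
  have "finite K"
  proof -
    have "inj_on (\<lambda>(e, g). [:- g / e, 1 / e:]) ({1, -1 :: complex} \<times> UNIV)"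
      by (rule inj_onI) auto
    then have "finite ((\<lambda>(e, g). [:- g / e, 1 / e:]) -` {p. poly N p = 0} \<inter> {1, -1} \<times> UNIV)"
      using N0 by (intro finite_vimage_IntI poly_roots_finite)
    moreover have "K \<subseteq> (\<lambda>(e, g). [:- g / e, 1 / e:]) -` {p. poly N p = 0} \<inter> {1, -1} \<times> UNIV"
      by (auto simp: K_def)
    ultimately show ?thesis by (rule finite_subset[rotated])
  qed
  define L where "L = (\<lambda>((e, g), j::int). {u. eval2 Q u (e * u + (g + of_int j)) = 0})"
  have L: "finite (L k)" if "k \<in> K \<times> UNIV" for k
  proof -
    obtain e g j where k: "k = ((e, g), j)" by (metis surj_pair)
    then have e: "e \<in> {1, -1}" using that by (auto simp: K_def)
    show ?thesis
    proof (rule ccontr)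
      assume inf: "infinite (L k)"
      have *: "eval2 Q u (e * u + (g + of_int j)) = 0" if "u \<in> L k" for u
        using that by (simp add: L_def k)
      have "e \<noteq> 0" using e by auto
      then show False using eval2_line_factor[OF inf *] noline[OF e] by blast
    qed
  qed
  define Bad2 where "Bad2 = Bad' \<union> (\<Union>k\<in>K \<times> UNIV. L k)"
  have bad2: "countable Bad2"
    unfolding Bad2_def using bad' \<open>finite K\<close> L
    by (intro countable_Un countable_UN countable_SIGMA) (auto intro: countable_finite)
  have const: "degree (poly Q [:u:]) = 0" if u: "u \<notin> Bad2" for u
  proof (rule ccontr)
    assume "degree (poly Q [:u:]) \<noteq> 0"
    then have "\<not> constant (poly (poly Q [:u:]))" by (simp add: constant_degree)
    then obtain \<alpha> where \<alpha>: "eval2 Q u \<alpha> = 0"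
      using fundamental_theorem_of_algebra unfolding eval2_def by blast
    have "u \<notin> Bad'" using u by (simp add: Bad2_def)
    then have R': "recurrence_at d (poly N [:u + of_int i:]) (poly N [:u + of_int i + 1:]) (poly N [:u + of_int i - 1:])" for i
      using R Bad' by blast
    have "eval2 N u \<alpha> = 0" using N \<alpha> by simp
    then obtain e g j where *: "e \<in> {1, -1}" "poly N [:- g / e, 1 / e:] = 0" "\<alpha> = e * u + g + of_int j"
      using root_on_line[OF R'] by metis
    then have "((e, g), j) \<in> K \<times> UNIV" "u \<in> L ((e, g), j)"
      using \<alpha> by (auto simp: K_def L_def add.assoc)
    then show False using u unfolding Bad2_def by blast
  qed
  note inf = infinite_compl_countable[OF bad2]
  obtain q where q: "\<And>u. eval2 Q u 0 = poly q u" using eval2_eq_poly by metis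
  have Q: "eval2 Q u s = poly q u" for u s
  proof -
    obtain qs where qs: "\<And>u. eval2 Q u s = poly qs u" using eval2_eq_poly by metis
    have "qs = q"
    proof (rule poly_eqI_infinite[OF inf])
      fix u assume "u \<in> - Bad2"
      then obtain c where "poly Q [:u:] = [:c:]" using const degree_eq_zeroE by (metis ComplD)
      then show "poly qs u = poly q u" using qs[of u] q[of u] by (simp add: eval2_def)
    qed
    then show ?thesis using qs by simp
  qed
  have Nu: "poly N [:u:] = smult (poly q u) (shift_poly (-u) A * shift_poly u B)" for u
    by (rule poly_eqI_infinite[OF infinite_UNIV_char_0])
      (use N[of u] in \<open>simp add: eval2_def[of N, symmetric] Q mult_ac\<close>)
  have lead: "lead_coeff (poly N [:u:]) = poly q u * (lead_coeff A * lead_coeff B)" for u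
    unfolding Nu by (simp add: lead_coeff_mult coeff_shift_top)
  have "q = [:poly q 0:]"
  proof (rule poly_periodic_const[OF infinite_compl_countable[OF bad], of 1])
    fix u assume "u \<in> - Bad"
    then show "poly q (u + 1) = poly q u"
      using recurrence_at_lead_coeff[OF R[of u]] A B by (simp add: lead)
  qed simp
  then have q0: "poly q u = poly q 0" for u by (metis poly_const_conv)
  define \<kappa> where "\<kappa> = poly q 0 * lead_coeff A * lead_coeff B"
  have qn: "poly q 0 \<noteq> 0"
  proof
    assume "poly q 0 = 0"
    then have "poly N [:u0:] = 0" using Nu[of u0] q0[of u0] by simp
    then show False using R[OF u0] by (simp add: recurrence_at_def)
  qed
  show thesis
  proof (rule that[of \<kappa> "smult (1 / lead_coeff A) A" "smult (1 / lead_coeff B) B"])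
    fix u s
    show "eval2 N u s = \<kappa> * poly (smult (1 / lead_coeff A) A) (s - u) * poly (smult (1 / lead_coeff B) B) (s + u)"
      using A B N[of u s] Q[of u s] q0[of u] by (simp add: \<kappa>_def)
  qed (use A B qn in \<open>auto simp: \<kappa>_def\<close>)
qed

section \<open>The three-term recurrence\<close>

lemma poly_family_coeff:
  assumes "poly_family P"
  shows "coeff (P n) n = 1" "i > n \<Longrightarrow> coeff (P n) i = 0"
  using assms unfolding poly_family_def by (metis, metis coeff_eq_0)

lemma poly_family_span:
  assumes P: "poly_family P" and "\<And>i. i \<ge> m \<Longrightarrow> coeff Q i = 0"
  shows "\<exists>e. Q = (\<Sum>i<m. smult (e i) (P i))"
  using assms(2)
proof (induction m arbitrary: Q)
  case 0
  then show ?case by (auto intro: poly_eqI)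
next
  case (Suc m)
  let ?Q = "Q - smult (coeff Q m) (P m)"
  have "coeff ?Q i = 0" if "i \<ge> m" for i
    using that Suc.prems[of i] poly_family_coeff[OF P] by (cases "i = m") auto
  then obtain e where e: "?Q = (\<Sum>i<m. smult (e i) (P i))" using Suc.IH by blast
  have "Q = (\<Sum>i<Suc m. smult ((e(m := coeff Q m)) i) (P i))"
    using e by (simp add: algebra_simps)
  then show ?case by blast
qed

lemma poly_family_independent:
  assumes P: "poly_family P" and "(\<Sum>i<m. smult (e i) (P i)) = 0" "i < m"
  shows "e i = 0"
  using assms(2,3)
proof (induction m)
  case (Suc m)
  have "coeff (\<Sum>i<m. smult (e i) (P i)) m = 0"
    by (simp add: coeff_sum poly_family_coeff[OF P])
  then have "e m = 0"
    using arg_cong[OF Suc.prems(1), of "\<lambda>p. coeff p m"] poly_family_coeff(1)[OF P] by simp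
  then show ?case using Suc by (auto simp: less_Suc_eq)
qed simp

lemma newton_basis_family: "poly_family (newton_basis R)"
proof -
  have "degree (newton_basis R n) = n \<and> lead_coeff (newton_basis R n) = 1" for n
  proof (induction n)
    case (Suc n)
    define L where "L = [:poly R (of_nat n), 1:]"
    have e: "newton_basis R (Suc n) = L * newton_basis R n"
      by (simp add: L_def algebra_simps)
    have "L \<noteq> 0" "degree L = 1" "lead_coeff L = 1" by (simp_all add: L_def)
    moreover have "newton_basis R n \<noteq> 0" "coeff (newton_basis R n) n = 1" using Suc by auto
    ultimately have "degree (newton_basis R (Suc n)) = Suc n" "lead_coeff (newton_basis R (Suc n)) = 1"
      unfolding e lead_coeff_mult using Suc by (auto simp: degree_mult_eq)
    then show ?case by blast
  qed simp
  then show ?thesis unfolding poly_family_def by blast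
qed

text \<open>The expansion of z P_(n+1) in the orthogonal family. Comparing z P_n with P_(n+1) shows
  that \<beta> n is the quotient of M(P_(n+1)^2) by M(P_n^2), hence nonzero. The remainder
  \<open>Q\<close> has degree below n + 2 and is orthogonal to P_0, ..., P_(n+1), so it
  vanishes.\<close>

lemma three_term_recurrence:
  assumes P: "poly_family P" and "quasi_orthogonal P"
  shows "\<exists>\<alpha> \<beta>. \<forall>n. \<beta> n \<noteq> 0 \<and>
    [:0, 1:] * P (Suc n) = P (Suc (Suc n)) + smult (\<alpha> n) (P (Suc n)) + smult (\<beta> n) (P n)"
proof -
  from assms(2) obtain M where lin: "Vector_Spaces.linear smult (*) M"
    and orth: "\<And>i j. i \<noteq> j \<Longrightarrow> M (P i * P j) = 0" and ne: "\<And>i. M (P i ^ 2) \<noteq> 0"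
    unfolding quasi_orthogonal_def by blast
  interpret M: Vector_Spaces.linear smult "(*)" M by (fact lin)
  have sum: "M (P n * (\<Sum>i<m. smult (e i) (P i))) = (\<Sum>i<m. e i * M (P n * P i))" for n m e
    by (simp add: sum_distrib_left M.sum M.scale)
  have low: "M (P n * Q) = 0" if Q: "\<And>i. i \<ge> n \<Longrightarrow> coeff Q i = 0" for n Q
  proof -
    obtain e where "Q = (\<Sum>i<n. smult (e i) (P i))" using poly_family_span[OF P Q] by blast
    then show ?thesis using orth by (simp add: sum)
  qed
  have nondeg: "Q = 0" if Q: "\<And>i. i \<ge> n \<Longrightarrow> coeff Q i = 0" "\<And>j. j < n \<Longrightarrow> M (P j * Q) = 0" for n Q
  proof -
    obtain e where e: "Q = (\<Sum>i<n. smult (e i) (P i))" using poly_family_span[OF P Q(1)] by blast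
    have "e j = 0" if "j < n" for j
    proof -
      have "M (P j * Q) = (\<Sum>i<n. e i * M (P j * P i))" using e sum by simp
      also have "\<dots> = (\<Sum>i\<in>{j}. e i * M (P j * P i))"
        using that orth by (intro sum.mono_neutral_right) auto
      finally show ?thesis using Q(2)[OF that] ne[of j] by (simp add: power2_eq_square)
    qed
    then show ?thesis using e by simp
  qed
  define X where "X = ([:0, 1:] :: complex poly)"
  have Xc: "coeff (X * Q) (Suc i) = coeff Q i" for Q i by (simp add: X_def)
  define \<beta> where "\<beta> n = M (P n * (X * P (Suc n))) / M (P n ^ 2)" for n
  define \<alpha> where "\<alpha> n = M (P (Suc n) * (X * P (Suc n) - P (Suc (Suc n)))) / M (P (Suc n) ^ 2)" for n
  have "\<beta> n \<noteq> 0" for n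
  proof -
    have "M (P (Suc n) * (X * P n - P (Suc n))) = 0"
    proof (rule low)
      fix i assume "i \<ge> Suc n"
      then show "coeff (X * P n - P (Suc n)) i = 0"
        using poly_family_coeff[OF P] by (cases i; cases "i = Suc n") (auto simp: Xc)
    qed
    moreover have "P (Suc n) * (X * P n - P (Suc n)) = P n * (X * P (Suc n)) - P (Suc n) ^ 2"
      by (simp add: algebra_simps power2_eq_square)
    ultimately have "M (P n * (X * P (Suc n))) = M (P (Suc n) ^ 2)" by (simp add: M.diff)
    then show ?thesis using ne by (simp add: \<beta>_def)
  qed
  moreover have "X * P (Suc n) = P (Suc (Suc n)) + smult (\<alpha> n) (P (Suc n)) + smult (\<beta> n) (P n)" for n
  proof -
    define Q where "Q = X * P (Suc n) - P (Suc (Suc n)) - smult (\<alpha> n) (P (Suc n)) - smult (\<beta> n) (P n)"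
    have "Q = 0"
    proof (rule nondeg[of "Suc (Suc n)"])
      fix i assume "i \<ge> Suc (Suc n)"
      then show "coeff Q i = 0"
        unfolding Q_def using poly_family_coeff[OF P] by (cases i; cases "i = Suc (Suc n)") (auto simp: Xc)
    next
      fix j assume "j < Suc (Suc n)"
      then consider "j = Suc n" | "j = n" | "j < n" by linarith
      then show "M (P j * Q) = 0"
      proof cases
        case 1
        have "P j * Q = P (Suc n) * (X * P (Suc n) - P (Suc (Suc n))) - smult (\<alpha> n) (P (Suc n) ^ 2) - smult (\<beta> n) (P (Suc n) * P n)"
          unfolding Q_def 1 by (simp add: algebra_simps power2_eq_square)
        then show ?thesis using orth ne by (simp add: M.diff M.scale \<alpha>_def)
      next
        case 2
        have "P j * Q = P n * (X * P (Suc n)) - P n * P (Suc (Suc n)) - smult (\<alpha> n) (P n * P (Suc n)) - smult (\<beta> n) (P n ^ 2)"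
          unfolding Q_def 2 by (simp add: algebra_simps power2_eq_square)
        then show ?thesis using orth ne by (simp add: M.diff M.scale \<beta>_def)
      next
        case 3
        have "M (P (Suc n) * (X * P j)) = 0"
        proof (rule low)
          fix i assume "i \<ge> Suc n"
          then show "coeff (X * P j) i = 0" using 3 poly_family_coeff[OF P] by (cases i) (auto simp: Xc)
        qed
        moreover have "P j * Q = P (Suc n) * (X * P j) - P j * P (Suc (Suc n)) - smult (\<alpha> n) (P j * P (Suc n)) - smult (\<beta> n) (P j * P n)"
          unfolding Q_def by (simp add: algebra_simps)
        ultimately show ?thesis using orth 3 by (simp add: M.diff M.scale)
      qed
    qed
    then show ?thesis by (simp add: Q_def algebra_simps)
  qed
  ultimately show ?thesis unfolding X_def by blast
qed

lemma smult_sum_right: "smult a (\<Sum>i\<in>I. f i) = (\<Sum>i\<in>I. smult a (f i))"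
  by (induction I rule: infinite_finite_induct) (simp_all add: smult_add_right)

lemma newton_coeffs_expand:
  assumes "newton_coeffs R P c" "n \<le> K"
  shows "P n = (\<Sum>k<Suc K. smult (c (int n) (int k)) (newton_basis R k))"
proof -
  have "P n = (\<Sum>k\<le>n. smult (c (int n) (int k)) (newton_basis R k))"
    using assms(1) by (simp add: newton_coeffs_def)
  also have "\<dots> = (\<Sum>k<Suc K. smult (c (int n) (int k)) (newton_basis R k))"
    using assms by (intro sum.mono_neutral_left) (auto simp: newton_coeffs_def)
  finally show ?thesis .
qed

lemma newton_coeffs_diag:
  assumes P: "poly_family P" and c: "newton_coeffs R P c"
  shows "c (int n) (int n) = 1"
proof -
  have "P n = (\<Sum>k<n. smult (c (int n) (int k)) (newton_basis R k)) + smult (c (int n) (int n)) (newton_basis R n)"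
    using newton_coeffs_expand[OF c order.refl, of n] by simp
  from arg_cong[OF this, of "\<lambda>p. coeff p n"] show ?thesis
    by (simp add: coeff_sum poly_family_coeff[OF P] poly_family_coeff[OF newton_basis_family])
qed

text \<open>On the Newton basis multiplication by z acts as z \<Phi>_j = \<Phi>_(j+1) - R(j)
  \<Phi>_j, which produces the index k - 1 and the factor R(k); the coefficients are compared by
  independence.\<close>

lemma newton_coeffs_recurrence:
  assumes c: "newton_coeffs R P c"
    and rec: "[:0, 1:] * P (Suc n) = P (Suc (Suc n)) + smult \<alpha> (P (Suc n)) + smult \<beta> (P n)"
  shows "c (int n + 1) (int k - 1) - poly R (of_nat k) * c (int n + 1) (int k) =
    c (int n + 2) (int k) + \<alpha> * c (int n + 1) (int k) + \<beta> * c (int n) (int k)"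
proof -
  have zero: "c m j = 0" if "\<not> (m \<ge> j \<and> j \<ge> 0)" for m j
    using c that by (simp add: newton_coeffs_def)
  show ?thesis
  proof (cases "k \<le> n + 2")
    case False
    then show ?thesis by (simp add: zero)
  next
    case True
    define \<Phi> where "\<Phi> = newton_basis R"
    have X\<Phi>: "[:0, 1:] * \<Phi> j = \<Phi> (Suc j) - smult (poly R (of_nat j)) (\<Phi> j)" for j
      by (simp add: \<Phi>_def)
    let ?K = "Suc (Suc n)"
    let ?c = "\<lambda>j. c (int n + 1) (int j)"
    have "[:0, 1:] * P (Suc n) = (\<Sum>j<?K. smult (?c j) ([:0, 1:] * \<Phi> j))"
      using newton_coeffs_expand[OF c order.refl, of "Suc n"]
      by (simp add: \<Phi>_def sum_distrib_left add.commute del: mult_pCons_left sum.lessThan_Suc)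
    also have "\<dots> = (\<Sum>j<?K. smult (?c j) (\<Phi> (Suc j))) - (\<Sum>j<?K. smult (?c j * poly R (of_nat j)) (\<Phi> j))"
      unfolding X\<Phi> by (simp add: smult_diff_right sum_subtractf del: sum.lessThan_Suc)
    \<comment> \<open>The added summand j = 0 carries \<open>c (n + 1) (-1)\<close>, which is zero
      by convention.\<close>
    also have "(\<Sum>j<?K. smult (?c j) (\<Phi> (Suc j))) = (\<Sum>j<Suc ?K. smult (c (int n + 1) (int j - 1)) (\<Phi> j))"
      by (subst (2) sum.lessThan_Suc_shift) (simp add: zero del: sum.lessThan_Suc)
    also have "(\<Sum>j<?K. smult (?c j * poly R (of_nat j)) (\<Phi> j)) = (\<Sum>j<Suc ?K. smult (?c j * poly R (of_nat j)) (\<Phi> j))"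
      by (subst (2) sum.lessThan_Suc) (simp add: zero del: sum.lessThan_Suc)
    finally have L: "[:0, 1:] * P (Suc n) =
      (\<Sum>j<Suc ?K. smult (c (int n + 1) (int j - 1)) (\<Phi> j)) - (\<Sum>j<Suc ?K. smult (?c j * poly R (of_nat j)) (\<Phi> j))" .
    have e: "P (Suc (Suc n)) = (\<Sum>j<Suc ?K. smult (c (int n + 2) (int j)) (\<Phi> j))"
      "P (Suc n) = (\<Sum>j<Suc ?K. smult (?c j) (\<Phi> j))"
      "P n = (\<Sum>j<Suc ?K. smult (c (int n) (int j)) (\<Phi> j))"
      using newton_coeffs_expand[OF c, of "Suc (Suc n)" ?K] newton_coeffs_expand[OF c, of "Suc n" ?K]
        newton_coeffs_expand[OF c, of n ?K]
      by (simp_all add: \<Phi>_def add.commute del: sum.lessThan_Suc)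
    have "(\<Sum>j<Suc ?K. smult (c (int n + 1) (int j - 1) - ?c j * poly R (of_nat j)
        - c (int n + 2) (int j) - \<alpha> * ?c j - \<beta> * c (int n) (int j)) (\<Phi> j)) =
      [:0, 1:] * P (Suc n) - P (Suc (Suc n)) - smult \<alpha> (P (Suc n)) - smult \<beta> (P n)"
      unfolding L unfolding e
      by (simp add: smult_diff_left sum_subtractf smult_sum_right del: sum.lessThan_Suc)
    also have "\<dots> = 0" using rec by simp
    finally have S: "(\<Sum>j<Suc ?K. smult (c (int n + 1) (int j - 1) - ?c j * poly R (of_nat j)
        - c (int n + 2) (int j) - \<alpha> * ?c j - \<beta> * c (int n) (int j)) (\<Phi> j)) = 0" .
    have "c (int n + 1) (int k - 1) - ?c k * poly R (of_nat k)
        - c (int n + 2) (int k) - \<alpha> * ?c k - \<beta> * c (int n) (int k) = 0"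
      by (rule poly_family_independent[OF newton_basis_family S[unfolded \<Phi>_def]]) (use True in simp)
    then show ?thesis by (simp add: algebra_simps)
  qed
qed

section \<open>Extension of the recurrence to generic parameters\<close>

text \<open>If \<open>N\<close> vanished on the whole line s = z, every coefficient of
  \<open>N\<close> in \<open>u\<close> would be divisible by s - z, and so is \<open>d\<close>,
  contrary to coprimality.\<close>

lemma coprime_const_no_common_zero:
  fixes N :: "complex poly poly"
  assumes cop: "coprime N [:d:]" and z: "poly d z = 0"
  obtains u where "eval2 N u z \<noteq> 0"
proof (rule ccontr)
  assume *: "\<not> thesis"
  have ev: "poly (map_poly (\<lambda>p. poly p z) F) u = eval2 F u z" for F u
    by (induction F) (simp_all add: eval2_def map_poly_pCons)
  have "map_poly (\<lambda>p. poly p z) N = 0"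
    by (rule poly_eqI_infinite[OF infinite_UNIV_char_0]) (use * that in \<open>auto simp: ev\<close>)
  then have "poly (coeff N i) z = 0" for i by (metis coeff_0 coeff_map_poly poly_0)
  then have "[:[:- z, 1:]:] dvd N" by (simp add: const_poly_dvd_iff poly_eq_0_iff_dvd)
  moreover have "[:[:- z, 1:]:] dvd [:d:]" using z
    by (auto simp: const_poly_dvd_iff poly_eq_0_iff_dvd coeff_pCons split: nat.split)
  ultimately have "is_unit [:[:- z, 1:]:]" using cop by (meson coprime_common_divisor)
  then show False by (simp add: is_unit_const_poly_iff is_unit_pCons_iff)
qed

section \<open>The coefficient array of a quasi-orthogonal family\<close>

locale hg_recurrence =
  fixes N :: "complex poly poly" and d R :: "complex poly" and c :: "int \<Rightarrow> int \<Rightarrow> complex"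
    and \<alpha> \<beta> :: "nat \<Rightarrow> complex"
  assumes cop: "coprime N [:d:]" and d0: "d \<noteq> 0"
    and rel: "\<And>n k::int. poly d (of_int k) * c n (k + 1) = eval2 N (of_int n) (of_int k) * c n k"
    and diag: "\<And>n::nat. c (int n) (int n) = 1"
    and vanish: "\<And>n k. \<not> (n \<ge> k \<and> k \<ge> 0) \<Longrightarrow> c n k = 0"
    and rec: "\<And>n k::nat. c (int n + 1) (int k - 1) - poly R (of_nat k) * c (int n + 1) (int k) =
      c (int n + 2) (int k) + \<alpha> n * c (int n + 1) (int k) + \<beta> n * c (int n) (int k)"
    and \<beta>: "\<And>n. \<beta> n \<noteq> 0"
begin

lemma rel_nat: "poly d (of_nat k) * c (int n) (int (Suc k)) = eval2 N (of_nat n) (of_nat k) * c (int n) (int k)"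
  using rel[of "int k" "int n"] by (simp add: add.commute)

text \<open>Comes from \<open>c n (n + 1) = 0\<close>; this zero on the diagonal is the source of
  the factor s - u in all three cases.\<close>

lemma N_diag: "eval2 N (of_nat n) (of_nat n) = 0"
  using rel_nat[of n n] vanish[where n = "int n" and k = "1 + int n"] diag[of n] by simp

text \<open>The relation at negative \<open>k\<close> is essential here: for n = 0, k = -1 it reads
  d(-1) c(0,0) = 0. This zero accounts for the summand (s + 1) v(s) in (a) and for the factor s + 1
  in (b) and (c).\<close>

lemma d_minus_one: "poly d (-1) = 0"
  using rel[of "-1" 0] vanish[where n = 0 and k = "-1"] diag[of 0] by simp

lemma N_column_nonzero: "\<exists>u. eval2 N u (of_nat k) \<noteq> 0"
proof (cases "poly d (of_nat k) = 0")
  case True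
  then show ?thesis using coprime_const_no_common_zero[OF cop] by blast
next
  case False
  then have "eval2 N (of_nat (Suc k)) (of_nat k) \<noteq> 0"
    using rel_nat[of k "Suc k"] diag[of "Suc k"] by (metis mult_eq_0_iff zero_neq_one)
  then show ?thesis by blast
qed

lemma N_column_eventually: "eventually (\<lambda>n. eval2 N (of_nat n) (of_nat k) \<noteq> 0) sequentially"
proof -
  obtain f where f: "\<And>u. eval2 N u (of_nat k) = poly f u" using eval2_eq_poly by metis
  have "f \<noteq> 0" using N_column_nonzero[of k] f by auto
  then have "finite {n::nat. poly f (of_nat n) = 0}" using finite_nat_roots[of f 0] by simp
  then show ?thesis unfolding f by (simp add: eventually_cofinite flip: cofinite_eq_sequentially)
qed

text \<open>
  A zero of \<open>d\<close> at \<open>k \<ge> 0\<close> would force \<open>c n 0 = 0\<close> for all large \<open>n\<close>, and then for all \<open>n\<close>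
  because \<open>\<beta>\<close> does not vanish.
\<close>

lemma d_nonzero: "poly d (of_nat k) \<noteq> 0"
proof
  assume k: "poly d (of_nat k) = 0"
  have "eventually (\<lambda>n. c (int n) (int k) = 0) sequentially"
    using N_column_eventually[of k]
    by eventually_elim (use rel_nat k in \<open>metis mult_eq_0_iff\<close>)
  moreover have "eventually (\<lambda>n. c (int n) 0 = 0) sequentially"
    if "eventually (\<lambda>n. c (int n) (int j) = 0) sequentially" for j
    using that
  proof (induction j)
    case (Suc j)
    from Suc.prems N_column_eventually[of j]
    have "eventually (\<lambda>n. c (int n) (int j) = 0) sequentially"
      by eventually_elim (use rel_nat in \<open>metis mult_eq_0_iff\<close>)
    then show ?case by (rule Suc.IH)
  qed simp
  ultimately have "eventually (\<lambda>n. c (int n) 0 = 0) sequentially" by blast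
  then obtain n0 where n0: "\<And>n. n \<ge> n0 \<Longrightarrow> c (int n) 0 = 0"
    by (auto simp: eventually_sequentially)
  have "\<forall>n\<ge>n0 - i. c (int n) 0 = 0" for i
  proof (induction i)
    case 0
    then show ?case using n0 by simp
  next
    case (Suc i)
    show ?case
    proof (intro allI impI)
      fix n assume n: "n \<ge> n0 - Suc i"
      show "c (int n) 0 = 0"
      proof (cases "n \<ge> n0 - i")
        case False
        then have "n + 1 \<ge> n0 - i" "n + 2 \<ge> n0 - i" using n by linarith+
        then have "c (int (n + 1)) 0 = 0" "c (int (n + 2)) 0 = 0" using Suc by blast+
        then have "\<beta> n * c (int n) 0 = 0"
          using rec[of n 0] vanish[where n = "int n + 1" and k = "-1"] by (simp add: add.commute)
        then show ?thesis using \<beta> by simp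
      qed (use Suc in blast)
    qed
  qed
  from this[of n0] have "\<forall>n. c (int n) 0 = 0" by simp
  then have "c (int 0) 0 = 0" by blast
  then show False using diag[of 0] by simp
qed

text \<open>Downward induction on \<open>k\<close> from \<open>c n n = 1\<close>: since
  \<open>d\<close> has no zero at a natural number, \<open>c n (k + 1)\<close> being nonzero forces
  both factors \<open>N n k\<close> and \<open>c n k\<close> to be nonzero.\<close>

lemma N_nonzero_c_nonzero:
  "k \<le> n \<Longrightarrow> c (int n) (int k) \<noteq> 0" "k < n \<Longrightarrow> eval2 N (of_nat n) (of_nat k) \<noteq> 0"
proof -
  have *: "c (int n) (int k) \<noteq> 0" if "k \<le> n" for k
    using that
  proof (induction rule: inc_induct)
    case base
    then show ?case using diag[of n] by simp
  next
    case (step k)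
    then show ?case using rel_nat[of k n] d_nonzero[of k] by auto
  qed
  show "k \<le> n \<Longrightarrow> c (int n) (int k) \<noteq> 0" by (rule *)
  show "k < n \<Longrightarrow> eval2 N (of_nat n) (of_nat k) \<noteq> 0"
    using rel_nat[of k n] d_nonzero[of k] *[of "Suc k"] by (metis Suc_leI mult_eq_0_iff)
qed

text \<open>At u = n this is c n k / c n 0.\<close>

definition col :: "nat \<Rightarrow> complex \<Rightarrow> complex" where
  "col k u = (\<Prod>j<k. eval2 N u (of_nat j) / poly d (of_nat j))"

lemma col_0 [simp]: "col 0 u = 1"
  by (simp add: col_def)

lemma col_Suc: "col (Suc k) u = col k u * (eval2 N u (of_nat k) / poly d (of_nat k))"
  by (simp add: col_def)

lemma c_eq_col: "c (int n) (int k) = c (int n) 0 * col k (of_nat n)"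
proof (induction k)
  case (Suc k)
  have "c (int n) (int (Suc k)) = eval2 N (of_nat n) (of_nat k) / poly d (of_nat k) * c (int n) (int k)"
    using rel_nat[of k n] d_nonzero[of k] by (simp add: field_simps)
  then show ?case using Suc by (simp add: col_Suc)
qed simp

definition \<rho> :: "nat \<Rightarrow> complex" where
  "\<rho> k = poly R (of_nat k) - poly R 0"

text \<open>The equation for k = 0 expresses \<alpha> n through \<open>a\<close>, \<open>b\<close>
  and R(0). Substituting it turns the others into equations between differences with two unknowns
  only, and replaces R by R - R(0). The unknowns are \<open>a\<close> = c(n+2,0)/c(n+1,0) and
  \<open>b\<close> = \<beta>(n) c(n,0)/c(n+1,0).\<close>

lemma col_recurrence_nat:
  obtains a b where "a \<noteq> 0" "b \<noteq> 0" "\<And>k. a * (col (Suc k) (of_nat (Suc (Suc n))) - col (Suc k) (of_nat (Suc n)))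
    + b * (col (Suc k) (of_nat n) - col (Suc k) (of_nat (Suc n))) =
    col k (of_nat (Suc n)) - \<rho> (Suc k) * col (Suc k) (of_nat (Suc n))"
proof -
  define e where "e m = c (int m) 0" for m
  have e: "e m \<noteq> 0" for m using N_nonzero_c_nonzero(1)[of 0 m] by (simp add: e_def)
  have C: "c (int m) (int k) = e m * col k (of_nat m)" for m k
    unfolding e_def by (rule c_eq_col)
  define a where "a = e (Suc (Suc n)) / e (Suc n)"
  define b where "b = \<beta> n * e n / e (Suc n)"
  have ae: "e (Suc (Suc n)) = e (Suc n) * a" "\<beta> n * e n = e (Suc n) * b"
    using e by (simp_all add: a_def b_def)
  have i: "int n + 1 = int (Suc n)" "int n + 2 = int (Suc (Suc n))" by simp_all
  have 0: "- poly R 0 = a + \<alpha> n + b"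
  proof -
    have "c (int (Suc n)) (int 0 - 1) = 0" by (rule vanish) simp
    then have "- (poly R 0 * e (Suc n)) = e (Suc (Suc n)) + \<alpha> n * e (Suc n) + \<beta> n * e n"
      using rec[of n 0] unfolding i C col_0 by simp
    then have "e (Suc n) * (- poly R 0) = e (Suc n) * (a + \<alpha> n + b)"
      unfolding ae by (simp add: algebra_simps)
    then show ?thesis using e[of "Suc n"] by (simp only: mult_cancel_left) simp
  qed
  have "a * (col (Suc k) (of_nat (Suc (Suc n))) - col (Suc k) (of_nat (Suc n)))
    + b * (col (Suc k) (of_nat n) - col (Suc k) (of_nat (Suc n))) =
    col k (of_nat (Suc n)) - \<rho> (Suc k) * col (Suc k) (of_nat (Suc n))" for k
  proof -
    have j: "int (Suc k) - 1 = int k" by simp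
    have "e (Suc n) * col k (of_nat (Suc n)) - poly R (of_nat (Suc k)) * (e (Suc n) * col (Suc k) (of_nat (Suc n))) =
      e (Suc (Suc n)) * col (Suc k) (of_nat (Suc (Suc n))) + \<alpha> n * (e (Suc n) * col (Suc k) (of_nat (Suc n)))
      + \<beta> n * (e n * col (Suc k) (of_nat n))"
      using rec[of n "Suc k"] unfolding i j C .
    also have "\<dots> = e (Suc n) * (a * col (Suc k) (of_nat (Suc (Suc n))) + \<alpha> n * col (Suc k) (of_nat (Suc n))
        + b * col (Suc k) (of_nat n))"
      unfolding mult.assoc[of "\<beta> n", symmetric] ae by (simp only: algebra_simps)
    finally have "e (Suc n) * (col k (of_nat (Suc n)) - poly R (of_nat (Suc k)) * col (Suc k) (of_nat (Suc n))) =
      e (Suc n) * (a * col (Suc k) (of_nat (Suc (Suc n))) + \<alpha> n * col (Suc k) (of_nat (Suc n))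
        + b * col (Suc k) (of_nat n))"
      by (simp only: algebra_simps)
    then have "col k (of_nat (Suc n)) - poly R (of_nat (Suc k)) * col (Suc k) (of_nat (Suc n)) =
      a * col (Suc k) (of_nat (Suc (Suc n))) + \<alpha> n * col (Suc k) (of_nat (Suc n)) + b * col (Suc k) (of_nat n)"
      using e[of "Suc n"] by (simp only: mult_cancel_left) simp
    moreover have "\<alpha> n = - poly R 0 - a - b" using 0 by (simp add: algebra_simps)
    ultimately show ?thesis by (simp add: \<rho>_def algebra_simps del: of_nat_Suc)
  qed
  moreover have "a \<noteq> 0" "b \<noteq> 0" using e \<beta> by (simp_all add: a_def b_def)
  ultimately show ?thesis using that by blast
qed

lemma col_eq_poly: "\<exists>F. \<forall>k u. col k u = poly (F k) u"
proof -
  have "\<exists>f. \<forall>u. eval2 N u (of_nat j) = poly f u" for j :: nat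
    using eval2_eq_poly[of N "of_nat j"] by metis
  then obtain f where f: "\<And>j u. eval2 N u (of_nat j) = poly (f j) u" by metis
  have "col k u = poly (\<Prod>j<k. smult (1 / poly d (of_nat j)) (f j)) u" for k u
    by (simp add: col_def poly_prod f)
  then show ?thesis
    by (intro exI[of _ "\<lambda>k. \<Prod>j<k. smult (1 / poly d (of_nat j)) (f j)"]) blast
qed

text \<open>Cramer's rule for the indices \<open>1\<close> and \<open>2\<close> extends the recurrence coefficients to rational functions of \<open>u\<close>.\<close>

lemma col_recurrence:
  obtains F A B where "finite F" "\<And>u. u \<notin> F \<Longrightarrow> A u \<noteq> 0" "\<And>u. u \<notin> F \<Longrightarrow> B u \<noteq> 0"
    "\<And>u k. u \<notin> F \<Longrightarrow> A u * (col (Suc k) (u + 1) - col (Suc k) u) + B u * (col (Suc k) (u - 1) - col (Suc k) u) =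
      col k u - \<rho> (Suc k) * col (Suc k) u"
proof -
  obtain G where G: "\<And>k u. col k u = poly (G k) u" using col_eq_poly by blast
  define a where "a k = shift_poly 1 (G (Suc k)) - G (Suc k)" for k
  define b where "b k = shift_poly (-1) (G (Suc k)) - G (Suc k)" for k
  define r where "r k = G k - smult (\<rho> (Suc k)) (G (Suc k))" for k
  define \<Delta> where "\<Delta> = a 0 * b 1 - a 1 * b 0"
  define \<Delta>A where "\<Delta>A = r 0 * b 1 - r 1 * b 0"
  define \<Delta>B where "\<Delta>B = a 0 * r 1 - a 1 * r 0"
  have cram: "\<exists>x y. x \<noteq> 0 \<and> y \<noteq> 0 \<and> poly \<Delta>A (of_nat (Suc n)) = x * poly \<Delta> (of_nat (Suc n)) \<and>
    poly \<Delta>B (of_nat (Suc n)) = y * poly \<Delta> (of_nat (Suc n)) \<and>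
    (\<forall>k. poly (r k) (of_nat (Suc n)) = x * poly (a k) (of_nat (Suc n)) + y * poly (b k) (of_nat (Suc n)))" for n
  proof -
    obtain x y where x: "x \<noteq> 0" "y \<noteq> 0" and xy: "\<And>k. x * (col (Suc k) (of_nat (Suc (Suc n))) - col (Suc k) (of_nat (Suc n)))
    + y * (col (Suc k) (of_nat n) - col (Suc k) (of_nat (Suc n))) =
    col k (of_nat (Suc n)) - \<rho> (Suc k) * col (Suc k) (of_nat (Suc n))" using col_recurrence_nat[of n] by blast
    have "poly (r k) (of_nat (Suc n)) = x * poly (a k) (of_nat (Suc n)) + y * poly (b k) (of_nat (Suc n))" for k
      using xy[of k] by (simp add: G r_def a_def b_def add_ac)
    moreover from this have "poly \<Delta>A (of_nat (Suc n)) = x * poly \<Delta> (of_nat (Suc n))"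
      "poly \<Delta>B (of_nat (Suc n)) = y * poly \<Delta> (of_nat (Suc n))"
      unfolding \<Delta>A_def \<Delta>B_def \<Delta>_def poly_diff poly_mult by (simp_all only:) (simp_all add: algebra_simps)
    ultimately show ?thesis using x by blast
  qed
  have id: "\<Delta> * r k = \<Delta>A * a k + \<Delta>B * b k" for k
  proof (rule poly_eqI_infinite)
    show "infinite (range (\<lambda>n. of_nat (Suc n) :: complex))"
      by (rule range_inj_infinite) (auto simp: inj_def)
    fix u :: complex assume "u \<in> range (\<lambda>n. of_nat (Suc n))"
    then obtain n where u: "u = of_nat (Suc n)" by blast
    from cram[of n] obtain x y where *: "poly \<Delta>A u = x * poly \<Delta> u" "poly \<Delta>B u = y * poly \<Delta> u"
      "\<forall>k. poly (r k) u = x * poly (a k) u + y * poly (b k) u" unfolding u by blast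
    show "poly (\<Delta> * r k) u = poly (\<Delta>A * a k + \<Delta>B * b k) u"
      unfolding poly_mult poly_add using * by (simp add: algebra_simps)
  qed
  have N00: "eval2 N 0 0 = 0" "eval2 N 1 1 = 0" using N_diag[of 0] N_diag[of 1] by simp_all
  have Nn: "eval2 N 1 0 \<noteq> 0" "eval2 N 2 0 \<noteq> 0" "eval2 N 2 1 \<noteq> 0"
    using N_nonzero_c_nonzero(2)[of 0 1] N_nonzero_c_nonzero(2)[of 0 2] N_nonzero_c_nonzero(2)[of 1 2] by simp_all
  have dn: "poly d 0 \<noteq> 0" "poly d 1 \<noteq> 0" using d_nonzero[of 0] d_nonzero[of 1] by simp_all
  \<comment> \<open>The determinant is tested at u = 1, where N(0,0) = N(1,1) = 0 kills
    \<open>b 1\<close> and leaves the single product of \<open>a 1\<close> and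
    \<open>b 0\<close>.\<close>
  have "poly (b 1) 1 = 0" "poly (b 0) 1 \<noteq> 0" "poly (a 1) 1 \<noteq> 0"
    using N00 Nn dn by (simp_all add: a_def b_def G[symmetric] col_Suc)
  then have "poly \<Delta> 1 \<noteq> 0" by (simp add: \<Delta>_def)
  moreover from this have "poly \<Delta>A 1 \<noteq> 0" "poly \<Delta>B 1 \<noteq> 0" using cram[of 0] by auto
  ultimately have ne: "\<Delta> \<noteq> 0" "\<Delta>A \<noteq> 0" "\<Delta>B \<noteq> 0" by auto
  define F where "F = {u. poly (\<Delta> * \<Delta>A * \<Delta>B) u = 0}"
  show thesis
  proof (rule that[of F "\<lambda>u. poly \<Delta>A u / poly \<Delta> u" "\<lambda>u. poly \<Delta>B u / poly \<Delta> u"])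
    show "finite F" unfolding F_def using ne by (intro poly_roots_finite) auto
    fix u assume u: "u \<notin> F"
    then show "poly \<Delta>A u / poly \<Delta> u \<noteq> 0" "poly \<Delta>B u / poly \<Delta> u \<noteq> 0" by (auto simp: F_def)
    fix k
    have *: "poly \<Delta> u \<noteq> 0" using u by (auto simp: F_def)
    have "poly \<Delta> u * poly (r k) u = poly \<Delta>A u * poly (a k) u + poly \<Delta>B u * poly (b k) u"
      using arg_cong[OF id[of k], of "\<lambda>p. poly p u"] by simp
    then have "poly (r k) u = poly \<Delta>A u / poly \<Delta> u * poly (a k) u + poly \<Delta>B u / poly \<Delta> u * poly (b k) u"
      using * by (simp add: field_simps)
    then show "poly \<Delta>A u / poly \<Delta> u * (col (Suc k) (u + 1) - col (Suc k) u) +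
        poly \<Delta>B u / poly \<Delta> u * (col (Suc k) (u - 1) - col (Suc k) u) =
      col k u - \<rho> (Suc k) * col (Suc k) u"
      by (simp add: r_def a_def b_def G)
  qed
qed

definition shifted_R :: "complex poly" where
  "shifted_R = shift_poly 1 R - [:poly R 0:]"

lemma poly_shifted_R: "poly shifted_R s = poly R (s + 1) - poly R 0"
  by (simp add: shifted_R_def)

text \<open>Dividing by \<open>col (Suc k) u\<close> and multiplying by N(u,k) turns the term
  \<open>col k u\<close> into d(k). The excluded parameters are zeros of some column of
  \<open>N\<close> at u, u + 1 or u - 1 (the countable part), those where N(u,s) and d(s) share a
  root (finitely many by coprimality), those where the specialisations at u + 1 and u - 1 agree at s
  = 0, and the finite set where the recurrence coefficients are undefined or zero.\<close>

lemma generic_recurrence: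
  obtains Bad A B where "countable Bad"
    "\<And>u. u \<notin> Bad \<Longrightarrow> A u \<noteq> 0 \<and> B u \<noteq> 0"
    "\<And>u j. u \<notin> Bad \<Longrightarrow> eval2 N u (of_nat j) \<noteq> 0 \<and> eval2 N (u + 1) (of_nat j) \<noteq> 0 \<and> eval2 N (u - 1) (of_nat j) \<noteq> 0"
    "\<And>u z. u \<notin> Bad \<Longrightarrow> eval2 N u z = 0 \<Longrightarrow> poly d z \<noteq> 0"
    "\<And>u. u \<notin> Bad \<Longrightarrow> eval2 N (u + 1) 0 \<noteq> eval2 N (u - 1) 0"
    "\<And>u k. u \<notin> Bad \<Longrightarrow>
      eval2 N u (of_nat k) * (A u * (col (Suc k) (u + 1) / col (Suc k) u) + B u * (col (Suc k) (u - 1) / col (Suc k) u)) =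
      poly d (of_nat k) + eval2 N u (of_nat k) * (A u + B u - poly shifted_R (of_nat k))"
proof -
  obtain F A B where F: "finite F" "\<And>u. u \<notin> F \<Longrightarrow> A u \<noteq> 0" "\<And>u. u \<notin> F \<Longrightarrow> B u \<noteq> 0"
    "\<And>u k. u \<notin> F \<Longrightarrow> A u * (col (Suc k) (u + 1) - col (Suc k) u) + B u * (col (Suc k) (u - 1) - col (Suc k) u) =
      col k u - \<rho> (Suc k) * col (Suc k) u"
    using col_recurrence by blast
  have fin: "finite {u. eval2 N u z = 0}" if "\<exists>u. eval2 N u z \<noteq> 0" for z
  proof -
    obtain f where f: "\<And>u. eval2 N u z = poly f u" using eval2_eq_poly by metis
    then have "f \<noteq> 0" using that by auto
    then show ?thesis unfolding f by (rule poly_roots_finite)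
  qed
  define B1 where "B1 = (\<Union>j. {u. eval2 N u (of_nat j) = 0})"
  have B1: "countable B1"
    unfolding B1_def using countable_finite[OF fin[OF N_column_nonzero]]
    by (intro countable_UN countableI_type)
  define B2 where "B2 = (\<Union>z\<in>{z. poly d z = 0}. {u. eval2 N u z = 0})"
  have "finite B2"
    unfolding B2_def
  proof (intro finite_UN_I poly_roots_finite[OF d0] fin)
    fix z assume "z \<in> {z. poly d z = 0}"
    then show "\<exists>u. eval2 N u z \<noteq> 0" using coprime_const_no_common_zero[OF cop] by blast
  qed
  define B3 where "B3 = {u. eval2 N (u + 1) 0 = eval2 N (u - 1) 0}"
  \<comment> \<open>Otherwise N(u,0) would be 2-periodic, hence constant in \<open>u\<close>,
    although N(0,0) = 0 and N(1,0) is nonzero.\<close>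
  have "finite B3"
  proof (rule ccontr)
    assume inf: "infinite B3"
    obtain f where f: "\<And>u. eval2 N u 0 = poly f u" using eval2_eq_poly by metis
    have "infinite ((\<lambda>u. u - 1) ` B3)" using inf by (auto simp: finite_image_iff inj_on_def)
    then have "f = [:poly f 0:]"
      by (rule poly_periodic_const[of _ 2]) (auto simp: B3_def f add.commute)
    then have "poly f 1 = poly f 0" by (metis poly_const_conv)
    then show False using N_diag[of 0] N_nonzero_c_nonzero(2)[of 0 1] f by simp
  qed
  define Bad where "Bad = F \<union> B1 \<union> (\<lambda>u. u - 1) ` B1 \<union> (\<lambda>u. u + 1) ` B1 \<union> B2 \<union> B3"
  show thesis
  proof (rule that[of Bad A B])
    show "countable Bad" unfolding Bad_def
      using B1 F(1) \<open>finite B2\<close> \<open>finite B3\<close>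
      by (intro countable_Un countable_image[OF B1]) (simp_all add: countable_finite)
    fix u assume u: "u \<notin> Bad"
    show "A u \<noteq> 0 \<and> B u \<noteq> 0" using u F by (simp add: Bad_def)
    have "u \<notin> B1" "u + 1 \<notin> B1" "u - 1 \<notin> B1"
      using u by (auto simp: Bad_def image_iff)
    then show N: "eval2 N u (of_nat j) \<noteq> 0 \<and> eval2 N (u + 1) (of_nat j) \<noteq> 0 \<and> eval2 N (u - 1) (of_nat j) \<noteq> 0" for j
      by (auto simp: B1_def)
    show "poly d z \<noteq> 0" if "eval2 N u z = 0" for z using u that by (auto simp: Bad_def B2_def)
    show "eval2 N (u + 1) 0 \<noteq> eval2 N (u - 1) 0" using u by (auto simp: Bad_def B3_def)
    fix k
    have nz: "col k u \<noteq> 0" "col (Suc k) u \<noteq> 0" using N d_nonzero by (auto simp: col_def)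
    have expand: "n * (x * (p1 / p) + y * (p2 / p)) = n / p * (x * (p1 - p) + y * (p2 - p) + (x + y) * p)"
      if "p \<noteq> 0" for n x y p p1 p2 :: complex
      using that by (simp add: field_simps)
    have collect: "n / p * (q - r * p + z * p) = n * q / p + n * (z - r)"
      if "p \<noteq> 0" for n p q r z :: complex
      using that by (simp add: field_simps)
    have ratio: "eval2 N u (of_nat k) * col k u / col (Suc k) u = poly d (of_nat k)"
    proof -
      have "eval2 N u (of_nat k) * col k u = poly d (of_nat k) * col (Suc k) u"
        using d_nonzero[of k] by (simp add: col_Suc)
      then show ?thesis using nz by simp
    qed
    have rec: "A u * (col (Suc k) (u + 1) - col (Suc k) u) + B u * (col (Suc k) (u - 1) - col (Suc k) u) =
      col k u - \<rho> (Suc k) * col (Suc k) u"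
      using F(4) u by (simp add: Bad_def)
    have "eval2 N u (of_nat k) * (A u * (col (Suc k) (u + 1) / col (Suc k) u) + B u * (col (Suc k) (u - 1) / col (Suc k) u)) =
      poly d (of_nat k) + eval2 N u (of_nat k) * (A u + B u - \<rho> (Suc k))"
      unfolding expand[OF nz(2)] rec collect[OF nz(2)] ratio ..
    also have "\<rho> (Suc k) = poly shifted_R (of_nat k)" by (simp add: \<rho>_def poly_shifted_R add.commute)
    finally show "eval2 N u (of_nat k) * (A u * (col (Suc k) (u + 1) / col (Suc k) u) + B u * (col (Suc k) (u - 1) / col (Suc k) u)) =
      poly d (of_nat k) + eval2 N u (of_nat k) * (A u + B u - poly shifted_R (of_nat k))" .
  qed
qed

end

section \<open>From the generic recurrence to the lattice identity\<close>

context hg_recurrence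
begin

lemma generic_recurrence_at:
  obtains Bad where "countable Bad"
    "\<And>u. u \<notin> Bad \<Longrightarrow> recurrence_at d (poly N [:u:]) (poly N [:u + 1:]) (poly N [:u - 1:])"
proof -
  obtain Bad A B where Bad: "countable Bad"
    and AB: "\<And>u. u \<notin> Bad \<Longrightarrow> A u \<noteq> 0 \<and> B u \<noteq> 0"
    and nz: "\<And>u j. u \<notin> Bad \<Longrightarrow> eval2 N u (of_nat j) \<noteq> 0 \<and> eval2 N (u + 1) (of_nat j) \<noteq> 0 \<and> eval2 N (u - 1) (of_nat j) \<noteq> 0"
    and dz: "\<And>u z. u \<notin> Bad \<Longrightarrow> eval2 N u z = 0 \<Longrightarrow> poly d z \<noteq> 0"
    and ne: "\<And>u. u \<notin> Bad \<Longrightarrow> eval2 N (u + 1) 0 \<noteq> eval2 N (u - 1) 0"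
    and rec: "\<And>u k. u \<notin> Bad \<Longrightarrow>
      eval2 N u (of_nat k) * (A u * (col (Suc k) (u + 1) / col (Suc k) u) + B u * (col (Suc k) (u - 1) / col (Suc k) u)) =
      poly d (of_nat k) + eval2 N u (of_nat k) * (A u + B u - poly shifted_R (of_nat k))"
    using generic_recurrence by blast
  have "recurrence_at d (poly N [:u:]) (poly N [:u + 1:]) (poly N [:u - 1:])" if u: "u \<notin> Bad" for u
  proof -
    define x where "x k = A u * (col k (u + 1) / col k u)" for k
    define y where "y k = B u * (col k (u - 1) / col k u)" for k
    define E where "E = [:A u + B u:] - shifted_R"
    have c: "col k u \<noteq> 0" "col k (u + 1) \<noteq> 0" "col k (u - 1) \<noteq> 0" for k
      using nz[OF u] d_nonzero by (auto simp: col_def)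
    \<comment> \<open>The number \<open>e\<close> stands for d(k), which is the same at u and at u +
      1 or u - 1 and therefore cancels.\<close>
    have ratio: "m * (p1 * (n1 / e) / (p * (n / e))) * n = m * (p1 / p) * n1"
      if "e \<noteq> 0" "n \<noteq> 0" "p \<noteq> 0" for m p1 n1 e p n :: complex
      using that by (simp add: field_simps)
    have "x k \<noteq> 0 \<and> y k \<noteq> 0 \<and>
        x (Suc k) * poly (poly N [:u:]) (of_nat k) = x k * poly (poly N [:u + 1:]) (of_nat k) \<and>
        y (Suc k) * poly (poly N [:u:]) (of_nat k) = y k * poly (poly N [:u - 1:]) (of_nat k) \<and>
        poly (poly N [:u:]) (of_nat k) * (x (Suc k) + y (Suc k)) =
          poly d (of_nat k) + poly (poly N [:u:] * E) (of_nat k)" for k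
    proof (intro conjI)
      show "x k \<noteq> 0" "y k \<noteq> 0" using AB[OF u] c by (simp_all add: x_def y_def)
      have n: "eval2 N u (of_nat k) \<noteq> 0" using nz[OF u] by blast
      show "x (Suc k) * poly (poly N [:u:]) (of_nat k) = x k * poly (poly N [:u + 1:]) (of_nat k)"
        unfolding x_def col_Suc eval2_def[symmetric] by (rule ratio[OF d_nonzero n c(1)])
      show "y (Suc k) * poly (poly N [:u:]) (of_nat k) = y k * poly (poly N [:u - 1:]) (of_nat k)"
        unfolding y_def col_Suc eval2_def[symmetric] by (rule ratio[OF d_nonzero n c(1)])
      show "poly (poly N [:u:]) (of_nat k) * (x (Suc k) + y (Suc k)) =
          poly d (of_nat k) + poly (poly N [:u:] * E) (of_nat k)"
        using rec[OF u, of k] unfolding x_def y_def E_def poly_mult eval2_def by simp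
    qed
    moreover have "poly N [:u + 1:] \<noteq> poly N [:u - 1:]"
      using ne[OF u] by (auto simp: eval2_def)
    moreover have "poly N [:u:] \<noteq> 0" using nz[OF u, of 0] by (auto simp: eval2_def)
    moreover have "\<forall>z. poly (poly N [:u:]) z = 0 \<longrightarrow> poly d z \<noteq> 0"
      using dz[OF u] by (simp add: eval2_def)
    ultimately show ?thesis unfolding recurrence_at_def by blast
  qed
  then show ?thesis using that Bad by blast
qed

text \<open>In the quotient of the two products the factors B(j + u + 1)/B(j + u) and A(j - u -
  1)/A(j - u) telescope; only the end factors remain, here written without division.\<close>

lemma col_telescope:
  assumes N: "\<And>u s. eval2 N u s = \<kappa> * poly A (s - u) * poly B (s + u)"
  shows "col k (u + 1) * (poly A (of_nat k - u - 1) * poly B u) =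
    col k u * (poly A (- u - 1) * poly B (of_nat k + u))"
proof (induction k)
  case (Suc k)
  have i: "of_nat k - (u + 1) = of_nat k - u - 1" "of_nat k + (u + 1) = of_nat (Suc k) + u"
    "of_nat (Suc k) - u - 1 = of_nat k - u" by simp_all
  have "col (Suc k) (u + 1) * (poly A (of_nat (Suc k) - u - 1) * poly B u) =
     (col k (u + 1) * (poly A (of_nat k - u - 1) * poly B u)) *
      (\<kappa> * poly A (of_nat k - u) * poly B (of_nat (Suc k) + u) / poly d (of_nat k))"
    unfolding col_Suc N i by (simp del: of_nat_Suc)
  also have "\<dots> = col (Suc k) u * (poly A (- u - 1) * poly B (of_nat (Suc k) + u))"
    unfolding Suc.IH unfolding col_Suc N by (simp del: of_nat_Suc)
  finally show ?case .
qed simp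

text \<open>After telescoping, the equation at index \<open>k\<close> times A(s - u) B(s + u) is
  polynomial in s = k. It holds at all naturals and is therefore an identity in
  \<open>s\<close>.\<close>

lemma factorized_identity:
  assumes \<kappa>: "\<kappa> \<noteq> 0" and N: "\<And>u s. eval2 N u s = \<kappa> * poly A (s - u) * poly B (s + u)"
  shows "\<exists>S C a b. lattice_identity S A B (smult (1 / \<kappa>) d) shifted_R C a b"
proof -
  obtain Bad x y where Bad: "countable Bad"
    and xy: "\<And>u. u \<notin> Bad \<Longrightarrow> x u \<noteq> 0 \<and> y u \<noteq> 0"
    and nz: "\<And>u j. u \<notin> Bad \<Longrightarrow> eval2 N u (of_nat j) \<noteq> 0 \<and> eval2 N (u + 1) (of_nat j) \<noteq> 0 \<and> eval2 N (u - 1) (of_nat j) \<noteq> 0"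
    and "\<And>u z. u \<notin> Bad \<Longrightarrow> eval2 N u z = 0 \<Longrightarrow> poly d z \<noteq> 0"
    and "\<And>u. u \<notin> Bad \<Longrightarrow> eval2 N (u + 1) 0 \<noteq> eval2 N (u - 1) 0"
    and rec: "\<And>u k. u \<notin> Bad \<Longrightarrow>
      eval2 N u (of_nat k) * (x u * (col (Suc k) (u + 1) / col (Suc k) u) + y u * (col (Suc k) (u - 1) / col (Suc k) u)) =
      poly d (of_nat k) + eval2 N u (of_nat k) * (x u + y u - poly shifted_R (of_nat k))"
    using generic_recurrence by blast
  \<comment> \<open>The end factors of the telescoped products that do not depend on
    \<open>s\<close> are absorbed into the recurrence coefficients.\<close>
  define a where "a u = x u * poly A (- u - 1) / poly B u" for u
  define b where "b u = y u * poly B (u - 1) / poly A (- u)" for u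
  have "lattice_identity (- Bad) A B (smult (1 / \<kappa>) d) shifted_R (\<lambda>u. x u + y u) a b"
    unfolding lattice_identity_def
  proof (intro conjI ballI)
    show "infinite (- Bad)" by (rule infinite_compl_countable[OF Bad])
    fix u assume "u \<in> - Bad"
    then have u: "u \<notin> Bad" by simp
    have ABnz: "poly A (of_nat j - u) \<noteq> 0" "poly B (of_nat j + u) \<noteq> 0" for j
      using nz[OF u, of j] by (auto simp: N)
    have A0: "poly A (- u) \<noteq> 0" and B0: "poly B u \<noteq> 0" using ABnz[of 0] by simp_all
    have A1: "poly A (- u - 1) \<noteq> 0" and B1: "poly B (u - 1) \<noteq> 0"
      using nz[OF u, of 0] by (auto simp: N)
    show "a u \<noteq> 0" "b u \<noteq> 0" using xy[OF u] A0 A1 B0 B1 by (simp_all add: a_def b_def)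
    have cnz: "col k u \<noteq> 0" for k using nz[OF u] d_nonzero by (auto simp: col_def)
    show "smult (1 / \<kappa>) d + ([:x u + y u:] - shifted_R) * (shift_poly (-u) A * shift_poly u B) =
        smult (a u) (shift_poly (u + 1) B * shift_poly u B) +
        smult (b u) (shift_poly (1 - u) A * shift_poly (-u) A)"
    proof (rule poly_eqI_infinite)
      show "infinite (range (of_nat :: nat \<Rightarrow> complex))" by (rule range_inj_infinite) (simp add: inj_def)
      fix s :: complex assume "s \<in> range of_nat"
      then obtain k where s: "s = of_nat k" by blast
      have As: "poly A (s - u) \<noteq> 0" and Bs: "poly B (s + u) \<noteq> 0" using ABnz by (simp_all add: s)
      have i: "of_nat (Suc k) - u - 1 = s - u" "of_nat (Suc k) + u = s + (u + 1)"
        "of_nat (Suc k) - (u - 1) - 1 = s + (1 - u)" "of_nat (Suc k) + (u - 1) = s + u"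
        "u - 1 + 1 = u" "- (u - 1) - 1 = - u" by (simp_all add: s)
      have quot: "p / r = t / q" if "p * q = r * t" "r \<noteq> 0" "q \<noteq> 0" for p q r t :: complex
        using that by (simp add: frac_eq_eq mult.commute)
      have clear: "\<kappa> * p * q * (a1 * q1 / p + b1 * p1 / q) = \<kappa> * (a1 * (q1 * q) + b1 * (p1 * p))"
        if "p \<noteq> 0" "q \<noteq> 0" for a1 b1 p q p1 q1 :: complex
        using that by (simp add: field_simps)
      have "col (Suc k) (u + 1) / col (Suc k) u = poly A (- u - 1) * poly B (s + (u + 1)) / (poly A (s - u) * poly B u)"
        using As B0 by (intro quot[OF col_telescope[OF N, of "Suc k" u, unfolded i] cnz]) simp
      then have X: "x u * (col (Suc k) (u + 1) / col (Suc k) u) = a u * poly B (s + (u + 1)) / poly A (s - u)"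
        by (simp add: a_def mult_ac)
      have "col (Suc k) (u - 1) / col (Suc k) u = poly A (s + (1 - u)) * poly B (u - 1) / (poly A (- u) * poly B (s + u))"
        using Bs A0 by (intro quot[OF col_telescope[OF N, of "Suc k" "u - 1", unfolded i, symmetric] cnz]) simp
      then have Y: "y u * (col (Suc k) (u - 1) / col (Suc k) u) = b u * poly A (s + (1 - u)) / poly B (s + u)"
        by (simp add: b_def mult_ac)
      have "eval2 N u s * (a u * poly B (s + (u + 1)) / poly A (s - u) + b u * poly A (s + (1 - u)) / poly B (s + u)) =
        \<kappa> * (a u * (poly B (s + (u + 1)) * poly B (s + u)) + b u * (poly A (s + (1 - u)) * poly A (s - u)))"
        unfolding N by (rule clear[OF As Bs])
      moreover have "eval2 N u s * (a u * poly B (s + (u + 1)) / poly A (s - u) + b u * poly A (s + (1 - u)) / poly B (s + u)) =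
        poly d s + eval2 N u s * (x u + y u - poly shifted_R s)"
        using rec[OF u, of k] unfolding X Y s .
      ultimately have "\<kappa> * (a u * (poly B (s + (u + 1)) * poly B (s + u)) + b u * (poly A (s + (1 - u)) * poly A (s - u))) =
        \<kappa> * (poly d s / \<kappa> + poly A (s - u) * poly B (s + u) * (x u + y u - poly shifted_R s))"
        using \<kappa> unfolding N by (simp add: distrib_left)
      then have "a u * (poly B (s + (u + 1)) * poly B (s + u)) + b u * (poly A (s + (1 - u)) * poly A (s - u)) =
        poly d s / \<kappa> + poly A (s - u) * poly B (s + u) * (x u + y u - poly shifted_R s)"
        using \<kappa> by (simp only: mult_cancel_left) simp
      then show "poly (smult (1 / \<kappa>) d + ([:x u + y u:] - shifted_R) * (shift_poly (-u) A * shift_poly u B)) s =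
        poly (smult (a u) (shift_poly (u + 1) B * shift_poly u B) +
          smult (b u) (shift_poly (1 - u) A * shift_poly (-u) A)) s"
        by (simp add: mult.commute)
    qed
  qed
  then show ?thesis by blast
qed

end

section \<open>The case of linear \<open>A\<close>\<close>

lemma degree_1_explicit:
  assumes "degree p \<le> 1"
  obtains x y where "p = [:x, y:]"
proof -
  have "p = [:coeff p 0, coeff p 1:]"
    using assms by (intro poly_eqI) (auto simp: coeff_pCons coeff_eq_0 split: nat.split)
  then show ?thesis using that by blast
qed

text \<open>For \<open>A\<close> = s and \<open>B\<close> of degree at most 1, the product A(s - u)
  B(s + u) is s B(s) - w(u) with w(u) = u B(u). So H + w(u) r has degree at most 2, where H = D - s
  B r, and two parameters with different w(u) separate \<open>r\<close> from H. This is the origin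
  of the denominator in (a).\<close>

lemma lattice_identity_linear:
  assumes I: "lattice_identity S [:0, 1:] B D r C a b" and B: "degree B \<le> 1" "B \<noteq> 0"
  shows "degree r \<le> 2" "degree (D - [:0, 1:] * B * r) \<le> 2"
proof -
  have S: "infinite S" using I by (simp add: lattice_identity_def)
  obtain b0 b1 where b: "B = [:b0, b1:]"
    using degree_1_explicit[OF B(1)] by blast
  define w where "w u = poly [:0, b0, b1:] u" for u
  define H where "H = D - [:0, 1:] * B * r"
  have shift: "shift_poly (-u) [:0, 1:] * shift_poly u B = [:0, 1:] * B - [:w u:]" for u
    unfolding b w_def by (simp add: pcompose_pCons algebra_simps)
  have Hr: "degree (H + smult (w u) r) \<le> 2" if u: "u \<in> S" for u
  proof -
    have "H + smult (w u) r = smult (a u) (shift_poly (u + 1) B * shift_poly u B) +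
        smult (b u) (shift_poly (1 - u) [:0, 1:] * shift_poly (-u) [:0, 1:]) -
        smult (C u) ([:0, 1:] * B - [:w u:])"
      using lattice_identityD(1)[OF I u] unfolding shift H_def by (simp add: algebra_simps)
    also have "degree \<dots> \<le> 2"
      using B(1)
      by (intro degree_diff_le degree_add_le order.trans[OF degree_smult_le] order.trans[OF degree_mult_le]) auto
    finally show ?thesis .
  qed
  obtain u1 where u1: "u1 \<in> S" using S by (metis finite.emptyI ex_in_conv)
  obtain u2 where u2: "u2 \<in> S" "w u2 \<noteq> w u1"
  proof (rule ccontr)
    assume "\<not> thesis"
    then have "[:0, b0, b1:] = [:w u1:]"
      using that by (intro poly_eqI_infinite[OF S]) (auto simp: w_def)
    then show False using B(2) b by (auto split: if_splits)
  qed
  have "r = smult (1 / (w u2 - w u1)) ((H + smult (w u2) r) - (H + smult (w u1) r))"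
    using u2(2) by (simp add: smult_diff_left[symmetric])
  moreover have "degree ((H + smult (w u2) r) - (H + smult (w u1) r)) \<le> 2"
    using Hr[OF u1] Hr[OF u2(1)] by (rule degree_diff_le[rotated])
  ultimately show r: "degree r \<le> 2" by (metis degree_smult_le order.trans)
  have "H = (H + smult (w u1) r) - smult (w u1) r" by simp
  also have "degree \<dots> \<le> 2"
    using Hr[OF u1] r by (intro degree_diff_le order.trans[OF degree_smult_le])
  finally show "degree (D - [:0, 1:] * B * r) \<le> 2" unfolding H_def .
qed

section \<open>The rational function\<close>

lemma eval2_eqI:
  assumes "\<And>u s. eval2 F u s = eval2 G u s"
  shows "F = G"
proof (rule ccontr)
  assume "F \<noteq> G"
  then have "finite {x. poly (F - G) x = 0}" by (intro poly_roots_finite) simp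
  moreover have "range (\<lambda>u. [:u:]) \<subseteq> {x. poly (F - G) x = 0}"
  proof clarify
    fix u
    have "poly F [:u:] = poly G [:u:]"
      by (rule poly_eqI_infinite[OF infinite_UNIV_char_0]) (use assms in \<open>simp add: eval2_def\<close>)
    then show "poly (F - G) [:u:] = 0" by simp
  qed
  moreover have "infinite (range (\<lambda>u::complex. [:u:]))"
    by (simp add: finite_image_iff inj_on_def infinite_UNIV_char_0)
  ultimately show False using finite_subset by blast
qed

definition subst2 :: "complex poly \<Rightarrow> complex poly poly \<Rightarrow> complex poly poly" where
  "subst2 p F = poly (map_poly (\<lambda>a. [:[:a:]:]) p) F"

lemma eval2_simps [simp]:
  "eval2 (F + G) u s = eval2 F u s + eval2 G u s" "eval2 (F - G) u s = eval2 F u s - eval2 G u s"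
  "eval2 0 u s = 0" "eval2 1 u s = 1"
  "eval2 (numeral n) u s = numeral n"
  "eval2 (smult p F) u s = poly p s * eval2 F u s" "eval2 [:[:a:]:] u s = a" "eval2 [:d:] u s = poly d s"
  "eval2 [:0, 1:] u s = u"
  by (simp_all add: eval2_def numeral_poly)

lemma eval2_subst2 [simp]: "eval2 (subst2 p F) u s = poly p (eval2 F u s)"
  unfolding subst2_def by (induction p) (simp_all add: map_poly_pCons)

lemma rat_subst_to_fract: "rat_subst p (to_fract F) = to_fract (subst2 p F)"
proof -
  have "rat_const 0 = 0" by (simp add: rat_const_def)
  then show ?thesis
    unfolding rat_subst_def subst2_def
    by (induction p) (simp_all add: map_poly_pCons rat_const_def)
qed

lemma rat_const_half: "1 / 2 = rat_const (1 / 2)" "3 / 2 = rat_const (3 / 2)"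
proof -
  have two: "(2 :: complex poly poly fract) = to_fract [:[:2:]:]"
    "(3 :: complex poly poly fract) = to_fract [:[:3:]:]"
  proof -
    have "[:[:2:]:] = (1 + 1 :: complex poly poly)" "[:[:3:]:] = (1 + 1 + 1 :: complex poly poly)"
      unfolding one_pCons by simp_all
    then show "(2 :: complex poly poly fract) = to_fract [:[:2:]:]"
      "(3 :: complex poly poly fract) = to_fract [:[:3:]:]"
      by (simp_all only: to_fract_add to_fract_1) simp_all
  qed
  have one: "(1 :: complex poly poly fract) = to_fract [:[:1:]:]"
    unfolding one_pCons[symmetric] by simp
  have "rat_const (1 / 2) * 2 = 1" "rat_const (3 / 2) * 2 = 3"
    unfolding two rat_const_def to_fract_mult[symmetric] one by simp_all
  moreover have "(2 :: complex poly poly fract) \<noteq> 0" unfolding two by simp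
  ultimately show "1 / 2 = rat_const (1 / 2)" "3 / 2 = rat_const (3 / 2)"
    by (simp_all add: field_simps)
qed

lemma HG_family_recurrence:
  assumes "HG_family_given_by R f P" "quasi_orthogonal P"
  obtains N d c \<alpha> \<beta> where "f = to_fract N / to_fract [:d:]" "hg_recurrence N d R c \<alpha> \<beta>"
proof -
  note HG = assms(1)[unfolded HG_family_given_by_def]
  note P = HG[THEN conjunct1]
  from HG[THEN conjunct2] obtain N D where *: "coprime N D \<and> D \<noteq> 0 \<and> f = to_fract N / to_fract D \<and>
    hg_relation N D R P \<and> (\<exists>d. D = [:d:])" by (elim exE)
  note cop = *[THEN conjunct1] and D = *[THEN conjunct2, THEN conjunct1]
    and f = *[THEN conjunct2, THEN conjunct2, THEN conjunct1]
    and rel = *[THEN conjunct2, THEN conjunct2, THEN conjunct2, THEN conjunct1]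
    and ex = *[THEN conjunct2, THEN conjunct2, THEN conjunct2, THEN conjunct2]
  from ex obtain d where d: "D = [:d:]" by (elim exE)
  obtain c where c: "newton_coeffs R P c"
    and rel: "\<forall>n k::int. eval2 D (of_int n) (of_int k) * c n (k + 1) = eval2 N (of_int n) (of_int k) * c n k"
    using rel[unfolded hg_relation_def] by (elim exE conjE)
  obtain \<alpha> \<beta> where \<alpha>\<beta>: "\<forall>n. \<beta> n \<noteq> 0 \<and>
    [:0, 1:] * P (Suc n) = P (Suc (Suc n)) + smult (\<alpha> n) (P (Suc n)) + smult (\<beta> n) (P n)"
    using three_term_recurrence[OF P assms(2)] by (elim exE)
  have "hg_recurrence N d R c \<alpha> \<beta>"
  proof
    show "coprime N [:d:]" "d \<noteq> 0" using cop D d by simp_all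
    show "poly d (of_int k) * c n (k + 1) = eval2 N (of_int n) (of_int k) * c n k" for n k
      using rel d by simp
    show "c (int n) (int n) = 1" for n by (rule newton_coeffs_diag[OF P c])
    show "c n k = 0" if "\<not> (n \<ge> k \<and> k \<ge> 0)" for n k
      using c that by (simp add: newton_coeffs_def)
    show "c (int n + 1) (int k - 1) - poly R (of_nat k) * c (int n + 1) (int k) =
      c (int n + 2) (int k) + \<alpha> n * c (int n + 1) (int k) + \<beta> n * c (int n) (int k)" for n k
      by (rule newton_coeffs_recurrence[OF c \<alpha>\<beta>[rule_format, THEN conjunct2]])
    show "\<beta> n \<noteq> 0" for n by (rule \<alpha>\<beta>[rule_format, THEN conjunct1])
  qed
  from that[OF f[unfolded d] this] show ?thesis .
qed

context hg_recurrence
begin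

lemma degree_R_le:
  assumes "degree shifted_R \<le> m"
  shows "degree R \<le> m"
proof -
  have "degree (shifted_R + [:poly R 0:]) \<le> m" using assms by (intro degree_add_le) auto
  then show ?thesis by (simp add: shifted_R_def)
qed

lemma classification:
  obtains q v where "degree q \<le> 1" "degree v \<le> 1" "degree R \<le> 2"
    "\<And>u s. eval2 N u s = (s - u) * poly q (s + u)"
    "\<And>s. poly d s = s * poly q s * (poly R (s + 1) - poly R 0) + (s + 1) * poly v s"
  | g l \<kappa> where "degree R = 0" "\<kappa> \<noteq> 0"
    "\<And>u s. eval2 N u s = \<kappa> * l * (s - u) * (s - u + 1 - g) * ((s + u + 1) * (s + u + g))"
    "\<And>s. poly d s = \<kappa> * ((s + 1 / 2) * (s + 1))"
  | g l \<kappa> where "degree R = 0" "\<kappa> \<noteq> 0"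
    "\<And>u s. eval2 N u s = \<kappa> * l * (s - u) * (s - u + 1 - g) * ((s + u + 2) * (s + u + g + 1))"
    "\<And>s. poly d s = \<kappa> * ((s + 1) * (s + 3 / 2))"
proof -
  obtain Bad where Bad: "countable Bad"
    "\<And>u. u \<notin> Bad \<Longrightarrow> recurrence_at d (poly N [:u:]) (poly N [:u + 1:]) (poly N [:u - 1:])"
    using generic_recurrence_at by blast
  show thesis
  proof (rule lattice_factorization[OF Bad])
    fix \<kappa> A B
    assume \<kappa>: "\<kappa> \<noteq> 0" and A: "lead_coeff A = 1" and B: "lead_coeff B = 1"
      and N: "\<And>u s. eval2 N u s = \<kappa> * poly A (s - u) * poly B (s + u)"
    define D where "D = smult (1 / \<kappa>) d"
    have d: "d = smult \<kappa> D" using \<kappa> by (simp add: D_def)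
    obtain S C a b where I: "lattice_identity S A B D shifted_R C a b"
      using factorized_identity[OF \<kappa> N] unfolding D_def by blast
    have B0: "B \<noteq> 0" using B by auto
    \<comment> \<open>On the diagonal N(n,n) = 0 says A(0) B(2n) = 0 for all naturals n, and
      \<open>B\<close> cannot vanish at every 2n.\<close>
    have A0: "poly A 0 = 0"
    proof (rule ccontr)
      assume "poly A 0 \<noteq> 0"
      then have "poly B (of_nat n + of_nat n) = 0" for n using N_diag[of n] \<kappa> by (simp add: N)
      then have "poly B x = 0" if "x \<in> range (\<lambda>n::nat. 2 * of_nat n)" for x
        using that by (auto simp flip: mult_2)
      moreover have "infinite (range (\<lambda>n::nat. 2 * of_nat n :: complex))"
        by (intro range_inj_infinite) (auto simp: inj_def)
      ultimately have "B = 0" by (intro poly_eqI_infinite) auto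
      then show False using B0 by simp
    qed
    have degA: "degree A \<ge> 1"
    proof (rule ccontr)
      assume "\<not> degree A \<ge> 1"
      then obtain x where "A = [:x:]" by (metis degree_eq_zeroE less_one not_le)
      then show False using A A0 by simp
    qed
    have D: "D \<noteq> 0" "poly D (-1) = 0" using d0 d_minus_one \<kappa> by (simp_all add: D_def)
    have r: "poly shifted_R (-1) = 0" by (simp add: poly_shifted_R)
    from lattice_identity_classification[OF I A degA B D r] show thesis
    proof cases
      case 1
      then obtain x y where "A = [:x, y:]" using degree_1_explicit by (metis order.refl)
      then have A1: "A = [:0, 1:]" using A A0 1 by (auto split: if_splits)
      note L = lattice_identity_linear[OF I[unfolded A1] 1(2) B0]
      define q where "q = smult \<kappa> B"
      \<comment> \<open>What remains of \<open>d\<close> after removing s q(s) [R(s + 1) - R(0)];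
        its root -1 provides the factor s + 1, and the cofactor is \<open>v\<close>.\<close>
      define H where "H = smult \<kappa> (D - [:0, 1:] * B * shifted_R)"
      have "poly H (-1) = 0" using D r by (simp add: H_def)
      then obtain v where v: "H = [:1, 1:] * v" by (auto simp: poly_eq_0_iff_dvd)
      have dv: "degree v \<le> 1"
      proof (cases "v = 0")
        case False
        then have "degree H = Suc (degree v)" unfolding v by (subst degree_mult_eq) auto
        moreover have "degree H \<le> 2" unfolding H_def using L(2) by (metis degree_smult_le order.trans)
        ultimately show ?thesis by simp
      qed simp
      have dq: "degree q \<le> 1" using 1(2) by (simp add: q_def)
      have dR: "degree R \<le> 2" using degree_R_le L(1) by blast
      have Nq: "eval2 N u s = (s - u) * poly q (s + u)" for u s by (simp add: N A1 q_def)
      have dq': "poly d s = s * poly q s * (poly R (s + 1) - poly R 0) + (s + 1) * poly v s" for s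
      proof -
        have "d = [:0, 1:] * q * shifted_R + H" by (simp add: H_def d q_def smult_diff_right)
        then have "poly d s = poly ([:0, 1:] * q * shifted_R + [:1, 1:] * v) s" by (simp only: v)
        also have "\<dots> = s * poly q s * (poly R (s + 1) - poly R 0) + (s + 1) * poly v s"
          by (simp add: poly_shifted_R algebra_simps)
        finally show ?thesis .
      qed
      from that(1)[OF dq dv dR Nq dq'] show ?thesis .
    next
      case (2 A0' A1 B0' B1 e)
      have R0: "degree R = 0" using degree_R_le[of 0] 2(1) by simp
      have a0: "A0' = 0" using 2(2) A0 by simp
      have Ax: "poly A x = x * (x + A1)" for x using 2(2) a0 by (simp add: algebra_simps)
      have Bx: "poly B x = x\<^sup>2 + B1 * x + B0'" for x using 2(3) by (simp add: algebra_simps power2_eq_square)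
      \<comment> \<open>\<open>g\<close> becomes the constant c of (b) and (c). The roots of
        \<open>A\<close> are 0 and g - 1; equal discriminants give \<open>B\<close> the same
        difference of roots, and the value of A1 + B1 fixes their position.\<close>
      define g where "g = 1 - A1"
      have A1: "A1 = 1 - g" by (simp add: g_def)
      have ke: "\<kappa> * e \<noteq> 0" using \<kappa> 2(5) by simp
      have disc: "4 * B0' = B1\<^sup>2 - A1\<^sup>2"
      proof -
        have "4 * B0' = B1\<^sup>2 - (B1\<^sup>2 - 4 * B0')" by simp
        then show ?thesis unfolding 2(4) a0 by simp
      qed
      have k: "\<kappa> * e * (1 / e) = \<kappa>" using 2(5) by simp
      have factor: "poly [:h, 1 + h, 1:] s = (s + h) * (s + 1)" for h s :: complex
        by (simp add: algebra_simps)
      from 2(6) show ?thesis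
      proof
        assume *: "A1 + B1 = 2 \<and> D = smult e [:1 / 2, 3 / 2, 1:]"
        have B1: "B1 = 1 + g"
        proof -
          have "B1 = (A1 + B1) - A1" by simp
          then show ?thesis unfolding *[THEN conjunct1] g_def by simp
        qed
        have "4 * B0' = 4 * g"
          unfolding disc unfolding A1 B1 by (simp add: power2_eq_square algebra_simps)
        then have B0': "B0' = g" by simp
        have Bx': "poly B x = (x + 1) * (x + g)" for x
          unfolding Bx B1 B0' by (simp add: power2_eq_square algebra_simps)
        \<comment> \<open>The numerator carries the scalar \<kappa> and the denominator \<kappa> e,
          so \<lambda> = 1/e once the common scalar is pulled out.\<close>
        have E: "eval2 N u s = \<kappa> * e * (1 / e) * (s - u) * (s - u + 1 - g) * ((s + u + 1) * (s + u + g))" for u s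
            unfolding k N Ax Bx' A1 by (simp only: add_diff_eq mult.assoc)
        have F: "poly d s = \<kappa> * e * ((s + 1 / 2) * (s + 1))" for s
          proof -
            have "poly [:1 / 2, 3 / 2, 1:] s = (s + 1 / 2) * (s + 1)"
              using factor[of "1 / 2" s] by simp
            then show ?thesis unfolding d *[THEN conjunct2] poly_smult by (simp only: mult.assoc)
          qed
        from that(2)[OF R0 ke E F] show thesis .
      next
        assume *: "A1 + B1 = 4 \<and> D = smult e [:3 / 2, 5 / 2, 1:]"
        have B1: "B1 = 3 + g"
        proof -
          have "B1 = (A1 + B1) - A1" by simp
          then show ?thesis unfolding *[THEN conjunct1] g_def by simp
        qed
        have "4 * B0' = 4 * (2 * g + 2)"
          unfolding disc unfolding A1 B1 by (simp add: power2_eq_square algebra_simps)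
        then have B0': "B0' = 2 * g + 2" by (simp only: mult_cancel_left) simp
        have Bx': "poly B x = (x + 2) * (x + g + 1)" for x
          unfolding Bx B1 B0' by (simp add: power2_eq_square algebra_simps)
        have E: "eval2 N u s = \<kappa> * e * (1 / e) * (s - u) * (s - u + 1 - g) * ((s + u + 2) * (s + u + g + 1))" for u s
            unfolding k N Ax Bx' A1 by (simp only: add_diff_eq mult.assoc)
        have F: "poly d s = \<kappa> * e * ((s + 1) * (s + 3 / 2))" for s
          proof -
            have "poly [:3 / 2, 5 / 2, 1:] s = (s + 1) * (s + 3 / 2)"
              using factor[of "3 / 2" s] by (simp add: mult.commute)
            then show ?thesis unfolding d *[THEN conjunct2] poly_smult by (simp only: mult.assoc)
          qed
        from that(3)[OF R0 ke E F] show thesis .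
      qed
    qed
  qed
qed

end

theorem theorem1:
  fixes R :: "complex poly" and f :: "complex poly poly fract"
  assumes "\<exists>P. HG_family_given_by R f P \<and> quasi_orthogonal P"
  shows "(degree R \<le> 2 \<and>
          (\<exists>q v :: complex poly. degree q \<le> 1 \<and> degree v \<le> 1 \<and>
             var_s * rat_subst q var_s * (rat_subst R (var_s + 1) - rat_const (poly R 0))
               + (var_s + 1) * rat_subst v var_s \<noteq> 0 \<and>
             f = (var_s - var_u) * rat_subst q (var_s + var_u) /
                 (var_s * rat_subst q var_s * (rat_subst R (var_s + 1) - rat_const (poly R 0))
                   + (var_s + 1) * rat_subst v var_s)))
       \<or> (degree R = 0 \<and>
          (\<exists>c l :: complex.
             f = rat_const l * (var_s - var_u) * (var_s - var_u + 1 - rat_const c) *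
                 (((var_s + var_u + 1) * (var_s + var_u + rat_const c)) /
                  ((var_s + 1/2) * (var_s + 1)))))
       \<or> (degree R = 0 \<and>
          (\<exists>c l :: complex.
             f = rat_const l * (var_s - var_u) * (var_s - var_u + 1 - rat_const c) *
                 (((var_s + var_u + 2) * (var_s + var_u + rat_const c + 1)) /
                  ((var_s + 1) * (var_s + 3/2)))))"
proof -
  from assms obtain P where P: "HG_family_given_by R f P" "quasi_orthogonal P" by (elim exE conjE)
  show ?thesis
  proof (rule HG_family_recurrence[OF P])
    fix N d c \<alpha> \<beta>
    assume f: "f = to_fract N / to_fract [:d:]" and H: "hg_recurrence N d R c \<alpha> \<beta>"
    define U :: "complex poly poly" where "U = [:0, 1:]"
    define S :: "complex poly poly" where "S = [:[:0, 1:]:]"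
    have ev: "eval2 U u s = u" "eval2 S u s = s" for u s by (simp_all add: U_def S_def)
    have vars: "var_u = to_fract U" "var_s = to_fract S" by (simp_all add: var_u_def var_s_def U_def S_def)
    have two: "(2 :: complex poly poly fract) = to_fract (1 + 1)" by (simp only: to_fract_add to_fract_1) simp
    \<comment> \<open>Used to gather each rational expression into a single \<open>to_fract\<close>
      of a polynomial, where equality can be checked pointwise by \<open>eval2_eqI\<close>.\<close>
    note push = vars two rat_const_def to_fract_1[symmetric] to_fract_add[symmetric] to_fract_diff[symmetric]
      to_fract_mult[symmetric] rat_subst_to_fract
    have d0: "to_fract [:d:] \<noteq> 0" using H by (simp add: hg_recurrence_def)
    have cancel: "to_fract N / to_fract [:d:] = x * (y / z)"
      if "to_fract N = k * (x * y)" "to_fract [:d:] = k * z" for k x y z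
    proof -
      have "k \<noteq> 0" using d0 unfolding that(2) by simp
      then show ?thesis unfolding that by simp
    qed
    show ?thesis
    proof (rule hg_recurrence.classification[OF H])
      fix q v
      assume *: "degree q \<le> 1" "degree v \<le> 1" "degree R \<le> 2"
        "\<And>u s. eval2 N u s = (s - u) * poly q (s + u)"
        "\<And>s. poly d s = s * poly q s * (poly R (s + 1) - poly R 0) + (s + 1) * poly v s"
      have den: "var_s * rat_subst q var_s * (rat_subst R (var_s + 1) - rat_const (poly R 0))
                 + (var_s + 1) * rat_subst v var_s = to_fract [:d:]"
        unfolding push to_fract_eq_iff by (rule eval2_eqI) (simp add: * ev mult.assoc)
      have num: "(var_s - var_u) * rat_subst q (var_s + var_u) = to_fract N"
        unfolding push to_fract_eq_iff by (rule eval2_eqI) (simp add: * ev mult.assoc)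
      show ?thesis
        by (intro disjI1 conjI exI[of _ q] exI[of _ v] *) (simp_all only: den num f d0 not_False_eq_True)
    next
      fix g l \<kappa>
      assume *: "degree R = 0" "\<kappa> \<noteq> 0"
        "\<And>u s. eval2 N u s = \<kappa> * l * (s - u) * (s - u + 1 - g) * ((s + u + 1) * (s + u + g))"
        "\<And>s. poly d s = \<kappa> * ((s + 1 / 2) * (s + 1))"
      have "to_fract N = rat_const \<kappa> * (rat_const l * (var_s - var_u) * (var_s - var_u + 1 - rat_const g) *
          ((var_s + var_u + 1) * (var_s + var_u + rat_const g)))"
        unfolding push to_fract_eq_iff by (rule eval2_eqI) (simp add: * ev mult.assoc)
      moreover have "to_fract [:d:] = rat_const \<kappa> * ((var_s + 1/2) * (var_s + 1))"
        unfolding rat_const_half unfolding push to_fract_eq_iff by (rule eval2_eqI) (simp add: * ev mult.assoc)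
      ultimately show ?thesis
        unfolding f by (intro disjI2[OF disjI1] conjI exI[of _ g] exI[of _ l] cancel *(1))
    next
      fix g l \<kappa>
      assume *: "degree R = 0" "\<kappa> \<noteq> 0"
        "\<And>u s. eval2 N u s = \<kappa> * l * (s - u) * (s - u + 1 - g) * ((s + u + 2) * (s + u + g + 1))"
        "\<And>s. poly d s = \<kappa> * ((s + 1) * (s + 3 / 2))"
      have "to_fract N = rat_const \<kappa> * (rat_const l * (var_s - var_u) * (var_s - var_u + 1 - rat_const g) *
          ((var_s + var_u + 2) * (var_s + var_u + rat_const g + 1)))"
        unfolding push to_fract_eq_iff by (rule eval2_eqI) (simp add: * ev mult.assoc)
      moreover have "to_fract [:d:] = rat_const \<kappa> * ((var_s + 1) * (var_s + 3/2))"
        unfolding rat_const_half unfolding push to_fract_eq_iff by (rule eval2_eqI) (simp add: * ev mult.assoc)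
      ultimately show ?thesis
        unfolding f by (intro disjI2[OF disjI2] conjI exI[of _ g] exI[of _ l] cancel *(1))
    qed
  qed
qed

end
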